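(* Let $2\le r<\infty$, $2^{r-1}\le n\le2^r-1$, let $U_{1,\dots,1}=\{t\in\mathbf R^n:t_k\ge0\ \forall k\}$, let $f(t)\chi_{U_{1,\dots,1}}(t)$ be an original with values in $\mathcal A_r$, and let $u$ be either the spherical kernel (S) or the Cartesian kernel (C). Put $$g(t):=\int_0^{t_1}\cdots\int_0^{t_n}f(x)\,dx.$$ Then in the domain $\mathrm{Re}(p)>\max(a_1,0)$ $$\mathcal F^n(f\chi_{U_{1,\dots,1}}(t),u;p;\zeta)=\mathsf R_{e_1}\mathsf R_{e_2}\cdots\mathsf R_{e_n}\,\mathcal F^n(g(t)\chi_{U_{1,\dots,1}}(t),u;p;\zeta),$$ where for the spherical kernel $\mathsf R_{e_k}=p_0+p_1\mathsf S_{e_1}+\dots+p_k\mathsf S_{e_k}$, for the Cartesian kernel $\mathsf R_{e_k}=p_0+p_k\mathsf S_{e_k}$ ($k=1,\dots,n$), and $\mathsf S_{e_k}=-\partial/\partial\zeta_k$.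
   Context: Cayley–Dickson algebras: $\mathcal A_0=\mathbf R$ and $\mathcal A_{r+1}=\mathcal A_r\oplus\mathcal A_r\mathbf l$ with $(\xi+\eta\mathbf l)(\gamma+\delta\mathbf l)=(\xi\gamma-\delta^*\eta)+(\delta\xi+\eta\gamma^* )\mathbf l$, $(\xi+\eta\mathbf l)^*=\xi^*-\eta\mathbf l$. The standard basis of $\mathcal A_r$ is $i_0=1,i_1,\dots,i_{2^r-1}$, with $i_j^2=-1$, $i_ji_k=-i_ki_j$ for $j\ne k$, $j,k\ge1$. $\mathrm{Re}(z)=(z+z^* )/2$, $|z|^2=zz^*$, $\exp(z)=\sum_kz^k/k!$. Write $p=\sum_jp_ji_j$, $\zeta=\sum_j\zeta_ji_j$ with real $p_j,\zeta_j$. When $n<2^r-1$ one puts $p_m=\zeta_m=t_m=0$ for $m>n$. $\chi_U$ is the characteristic function of $U$. Originals: $f:\mathbf R^n\to\mathcal A_r$ is an original if (1) $f$ is continuous almost everywhere for the Lebesgue measure; (2) each partial function $t_j\mapsto f(t)$ has on each finite interval only finitely many discontinuities, all of the first kind; (3) each partial function $g_j(t_j)=f(t)$ satisfies, except possibly at its discontinuities of the first kind, a Hölder condition $|g_j(t_j+h)-g_j(t_j)|\le A_j|h|^{\alpha_j}$ for $|h|<\delta_j$, with constants $0<\alpha_j\le1$, $A_j,\delta_j>0$ (for the given $t$); (4) there are real $a_1,a_{-1}$ and constants $C_v>0$ such that for each $v\in\{-1,1\}^n$, $|f(t)|<C_v\exp(\sum_ja_{v_j}t_j)$ whenever $v_jt_j\ge0$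 for all $j$. For functions supported in $U_{1,\dots,1}$ only $a_1$ matters ($a_{-1}=\infty$). Kernels: (C) Cartesian: $u(p,t;\zeta)=p_0(t_1+\dots+t_n)+\sum_{j=1}^np_jt_ji_j+\zeta$. (S) Spherical: with $s_j=t_j+\dots+t_n$, $K=2^r-1$, $\phi_j=p_js_j+\zeta_j$: $u=p_0s_1+M+\zeta_0$, $M=\phi_1[i_1\cos\phi_2+i_2\sin\phi_2\cos\phi_3+\dots+i_{K-1}\sin\phi_2\cdots\sin\phi_{K-1}\cos\phi_K+i_K\sin\phi_2\cdots\sin\phi_K]$. Transform: $\mathcal F^n(f(t),u;p;\zeta)=\int_{\mathbf R^n}f(t)\exp(-u(p,t;\zeta))\,dt$. *)

theory Defs
  imports "HOL-Analysis.Analysis"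
begin

section \<open>Cayley--Dickson algebras\<close>

text \<open>
  An element of the algebra of level r is represented by its coordinates with respect to the
  standard basis \<open>i\<^sub>0 = 1, i\<^sub>1, \<dots>\<close>; these are functions on the natural numbers that vanish from
  \<open>2^r\<close> on. The doubling \<open>\<xi> + \<eta>l\<close> puts the coordinates of \<open>\<xi>\<close> below those of \<open>\<eta>\<close>: the
  basis element of index \<open>2^r\<close> is \<open>l\<close>, and that of index \<open>2^r + j\<close> is \<open>i\<^sub>j l\<close>.
\<close>

definition cd_lo :: "nat \<Rightarrow> (nat \<Rightarrow> real) \<Rightarrow> nat \<Rightarrow> real" where
  "cd_lo r x = (\<lambda>i. if i < 2 ^ r then x i else 0)"

definition cd_hi :: "nat \<Rightarrow> (nat \<Rightarrow> real) \<Rightarrow> nat \<Rightarrow> real" where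
  "cd_hi r x = (\<lambda>i. if i < 2 ^ r then x (2 ^ r + i) else 0)"

definition cd_join :: "nat \<Rightarrow> (nat \<Rightarrow> real) \<Rightarrow> (nat \<Rightarrow> real) \<Rightarrow> nat \<Rightarrow> real" where
  "cd_join r x y =
    (\<lambda>i. if i < 2 ^ r then x i else if i < 2 ^ Suc r then y (i - 2 ^ r) else 0)"

primrec cd_conj :: "nat \<Rightarrow> (nat \<Rightarrow> real) \<Rightarrow> nat \<Rightarrow> real" where
  "cd_conj 0 x = x"
| "cd_conj (Suc r) x = cd_join r (cd_conj r (cd_lo r x)) (\<lambda>i. - cd_hi r x i)"

primrec cd_mult :: "nat \<Rightarrow> (nat \<Rightarrow> real) \<Rightarrow> (nat \<Rightarrow> real) \<Rightarrow> nat \<Rightarrow> real" where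
  "cd_mult 0 x y = (\<lambda>i. if i = 0 then x 0 * y 0 else 0)"
| "cd_mult (Suc r) x y = cd_join r
    (\<lambda>i. cd_mult r (cd_lo r x) (cd_lo r y) i - cd_mult r (cd_conj r (cd_hi r y)) (cd_hi r x) i)
    (\<lambda>i. cd_mult r (cd_hi r y) (cd_lo r x) i + cd_mult r (cd_hi r x) (cd_conj r (cd_lo r y)) i)"

lemma cd_conj_support: "(\<forall>i\<ge>2 ^ r. x i = 0) \<Longrightarrow> i \<ge> 2 ^ r \<Longrightarrow> cd_conj r x i = 0"
  by (cases r) (auto simp: cd_join_def)

lemma cd_mult_support: "i \<ge> 2 ^ r \<Longrightarrow> cd_mult r x y i = 0"
  by (cases r) (auto simp: cd_join_def)

text \<open>The level is \<open>r = CARD('r)\<close>; the library has \<open>CARD('r) = 0\<close> for infinite \<open>'r\<close>.\<close>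

typedef 'r cayley = "{x :: nat \<Rightarrow> real. \<forall>i\<ge>2 ^ CARD('r). x i = 0}"
  morphisms cd_coeff Abs_cayley
  by (rule exI[of _ "\<lambda>_. 0"]) simp

setup_lifting type_definition_cayley

lemma cayley_eqI: "(\<And>i. cd_coeff x i = cd_coeff y i) \<Longrightarrow> x = y"
  by (simp add: cd_coeff_inject[symmetric] ext)

lemma cd_coeff_eq_0: "i \<ge> 2 ^ CARD('r) \<Longrightarrow> cd_coeff (x :: 'r cayley) i = 0"
  using cd_coeff[of x] by simp

lift_definition cbasis :: "nat \<Rightarrow> 'r cayley" is
  "\<lambda>j i. if i = j \<and> j < 2 ^ CARD('r) then 1 else 0" by auto

instantiation cayley :: (type) real_vector
begin

lift_definition zero_cayley :: "'r cayley" is "\<lambda>_. 0" by simp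
lift_definition plus_cayley :: "'r cayley \<Rightarrow> 'r cayley \<Rightarrow> 'r cayley"
  is "\<lambda>x y i. x i + y i" by simp
lift_definition minus_cayley :: "'r cayley \<Rightarrow> 'r cayley \<Rightarrow> 'r cayley"
  is "\<lambda>x y i. x i - y i" by simp
lift_definition uminus_cayley :: "'r cayley \<Rightarrow> 'r cayley" is "\<lambda>x i. - x i" by simp
lift_definition scaleR_cayley :: "real \<Rightarrow> 'r cayley \<Rightarrow> 'r cayley"
  is "\<lambda>a x i. a * x i" by simp

instance
  by standard (transfer; simp add: fun_eq_iff algebra_simps)+

end

instantiation cayley :: (type) "{one, times}"
begin

lift_definition one_cayley :: "'r cayley" is "\<lambda>i. if i = 0 then 1 else 0"
  by (metis not_gr_zero not_le zero_less_numeral zero_less_power)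
lift_definition times_cayley :: "'r cayley \<Rightarrow> 'r cayley \<Rightarrow> 'r cayley"
  is "cd_mult CARD('r)" by (simp add: cd_mult_support)

instance ..

end

text \<open>Multiplication is not associative from level 3 on; powers are \<open>z ^ Suc k = z * z ^ k\<close>.\<close>

instance cayley :: (type) power ..

lift_definition cayley_cnj :: "'r cayley \<Rightarrow> 'r cayley" is "cd_conj CARD('r)"
  by (simp add: cd_conj_support)

lemma cd_coeff_simps [simp]:
  "cd_coeff 0 i = 0"
  "cd_coeff (x + y) i = cd_coeff x i + cd_coeff y i"
  "cd_coeff (x - y) i = cd_coeff x i - cd_coeff y i"
  "cd_coeff (- x) i = - cd_coeff x i"
  "cd_coeff (a *\<^sub>R x) i = a * cd_coeff x i"
  "cd_coeff 1 i = (if i = 0 then 1 else 0)"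
  by (transfer; simp)+

lemma cd_coeff_cbasis: "cd_coeff (cbasis j :: 'r cayley) i = (if i = j \<and> j < 2 ^ CARD('r) then 1 else 0)"
  by transfer simp

lemma cd_coeff_sum [simp]: "cd_coeff (\<Sum>a\<in>A. h a) i = (\<Sum>a\<in>A. cd_coeff (h a) i)"
  by (induction A rule: infinite_finite_induct) auto

lemma cbasis_0: "cbasis 0 = 1"
  by (rule cayley_eqI) (simp add: cd_coeff_cbasis)

lemma cayley_expansion: "x = (\<Sum>i<2 ^ CARD('r). cd_coeff x i *\<^sub>R cbasis i)" for x :: "'r cayley"
  by (rule cayley_eqI) (auto simp: cd_coeff_cbasis cd_coeff_eq_0 if_distrib cong: if_cong)

instantiation cayley :: (type) real_inner
begin

definition inner_cayley :: "'r cayley \<Rightarrow> 'r cayley \<Rightarrow> real" where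
  "inner_cayley x y = (\<Sum>i<2 ^ CARD('r). cd_coeff x i * cd_coeff y i)"
definition norm_cayley :: "'r cayley \<Rightarrow> real" where "norm_cayley x = sqrt (inner x x)"
definition sgn_cayley :: "'r cayley \<Rightarrow> 'r cayley" where "sgn_cayley x = inverse (norm x) *\<^sub>R x"
definition dist_cayley :: "'r cayley \<Rightarrow> 'r cayley \<Rightarrow> real" where "dist_cayley x y = norm (x - y)"
definition uniformity_cayley :: "('r cayley \<times> 'r cayley) filter" where
  "uniformity_cayley = (INF e\<in>{0 <..}. principal {(x, y). dist x y < e})"
definition open_cayley :: "'r cayley set \<Rightarrow> bool" where
  "open_cayley U \<longleftrightarrow> (\<forall>x\<in>U. eventually (\<lambda>(x', y). x' = x \<longrightarrow> y \<in> U) uniformity)"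

instance
proof
  fix x y z :: "'r cayley" and a :: real and U :: "'r cayley set"
  show "dist x y = norm (x - y)" by (fact dist_cayley_def)
  show "sgn x = x /\<^sub>R norm x" by (fact sgn_cayley_def)
  show "uniformity = (INF e\<in>{0 <..}. principal {(x, y :: 'r cayley). dist x y < e})"
    by (fact uniformity_cayley_def)
  show "open U \<longleftrightarrow> (\<forall>x\<in>U. eventually (\<lambda>(x', y). x' = x \<longrightarrow> y \<in> U) uniformity)"
    by (fact open_cayley_def)
  show "inner x y = inner y x" by (simp add: inner_cayley_def mult.commute)
  show "inner (x + y) z = inner x z + inner y z"
    by (simp add: inner_cayley_def algebra_simps sum.distrib)
  show "inner (a *\<^sub>R x) y = a * inner x y"
    by (simp add: inner_cayley_def sum_distrib_left mult.assoc)
  show "0 \<le> inner x x" by (simp add: inner_cayley_def sum_nonneg)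
  show "inner x x = 0 \<longleftrightarrow> x = 0"
  proof
    assume "inner x x = 0"
    then have "\<forall>i<2 ^ CARD('r). cd_coeff x i = 0"
      by (simp add: inner_cayley_def sum_nonneg_eq_0_iff)
    then show "x = 0" by (intro cayley_eqI) (metis cd_coeff_eq_0 cd_coeff_simps(1) not_le)
  qed (simp add: inner_cayley_def)
  show "norm x = sqrt (inner x x)" by (fact norm_cayley_def)
qed

end

lemma inner_cbasis: "i < 2 ^ CARD('r) \<Longrightarrow> inner (x :: 'r cayley) (cbasis i) = cd_coeff x i"
  by (simp add: inner_cayley_def cd_coeff_cbasis if_distrib cong: if_cong)

instantiation cayley :: (type) euclidean_space
begin

definition Basis_cayley :: "'r cayley set" where "Basis_cayley = cbasis ` {..<2 ^ CARD('r)}"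

instance
proof
  show "(Basis :: 'r cayley set) \<noteq> {}" by (auto simp: Basis_cayley_def lessThan_empty_iff)
  show "finite (Basis :: 'r cayley set)" by (simp add: Basis_cayley_def)
  fix u v x :: "'r cayley"
  show "inner u v = (if u = v then 1 else 0)" if uv: "u \<in> Basis" "v \<in> Basis"
  proof -
    obtain i j where "u = cbasis i" "v = cbasis j" and ij: "i < 2 ^ CARD('r)" "j < 2 ^ CARD('r)"
      using uv unfolding Basis_cayley_def by blast
    then show ?thesis
      by (cases "i = j") (auto simp: inner_cbasis cd_coeff_cbasis dest!: arg_cong[where f = "\<lambda>x. cd_coeff x i"])
  qed
  show "(\<forall>u\<in>Basis. inner x u = 0) \<longleftrightarrow> x = 0"
  proof
    assume "\<forall>u\<in>Basis. inner x u = 0"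
    then have "cd_coeff x i = 0" if "i < 2 ^ CARD('r)" for i
      using that by (auto simp: Basis_cayley_def inner_cbasis)
    then show "x = 0"
      by (intro cayley_eqI) (metis cd_coeff_eq_0 cd_coeff_simps(1) not_le)
  qed (simp add: inner_cayley_def)
qed

end

text \<open>
  The next lemmas tie the coordinate model to the algebra: \<open>z z\<^sup>* = |z|\<^sup>2\<close> for the Euclidean
  norm, \<open>i\<^sub>j\<^sup>2 = -1\<close>, and \<open>i\<^sub>j i\<^sub>k = - i\<^sub>k i\<^sub>j\<close>.
\<close>

lemma cd_conj_coeff:
  "(\<forall>i\<ge>2 ^ r. x i = 0) \<Longrightarrow> cd_conj r x = (\<lambda>i. if i = 0 then x 0 else - x i)"
  for x :: "nat \<Rightarrow> real"
proof (induction r arbitrary: x)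
  case 0
  then show ?case by (auto simp: fun_eq_iff)
next
  case (Suc r)
  have "cd_conj r (cd_lo r x) = (\<lambda>i. if i = 0 then cd_lo r x 0 else - cd_lo r x i)"
    by (rule Suc.IH) (simp add: cd_lo_def)
  then show ?case
    using Suc.prems by (auto simp: fun_eq_iff cd_join_def cd_lo_def cd_hi_def)
qed

lemma cd_coeff_cnj: "cd_coeff (cayley_cnj x) i = (if i = 0 then cd_coeff x 0 else - cd_coeff x i)"
  by transfer (simp add: cd_conj_coeff)

lemma cd_conj_linear:
  "cd_conj r (\<lambda>i. a * x i + b * y i) = (\<lambda>i. a * cd_conj r x i + b * cd_conj r y i)"
proof (induction r arbitrary: x y)
  case (Suc r)
  have "cd_lo r (\<lambda>i. a * x i + b * y i) = (\<lambda>i. a * cd_lo r x i + b * cd_lo r y i)"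
    by (auto simp: cd_lo_def)
  then have "cd_conj r (cd_lo r (\<lambda>i. a * x i + b * y i)) =
      (\<lambda>i. a * cd_conj r (cd_lo r x) i + b * cd_conj r (cd_lo r y) i)"
    by (simp only: Suc.IH)
  then show ?case
    by (auto simp: fun_eq_iff cd_join_def cd_hi_def algebra_simps)
qed simp

lemma cd_mult_bilinear:
  "cd_mult r (\<lambda>i. a * x i + b * x' i) y = (\<lambda>i. a * cd_mult r x y i + b * cd_mult r x' y i)"
  "cd_mult r x (\<lambda>i. a * y i + b * y' i) = (\<lambda>i. a * cd_mult r x y i + b * cd_mult r x y' i)"
proof (induction r arbitrary: x x' y y')
  case 0
  {
    case 1
    show ?case by (auto simp: fun_eq_iff algebra_simps)
  next
    case 2
    show ?case by (auto simp: fun_eq_iff algebra_simps)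
  }
next
  case (Suc r)
  have lo: "cd_lo r (\<lambda>i. a * x i + b * x' i) = (\<lambda>i. a * cd_lo r x i + b * cd_lo r x' i)" for x x'
    by (auto simp: cd_lo_def)
  have hi: "cd_hi r (\<lambda>i. a * x i + b * x' i) = (\<lambda>i. a * cd_hi r x i + b * cd_hi r x' i)" for x x'
    by (auto simp: cd_hi_def)
  {
    case 1
    show ?case by (auto simp: fun_eq_iff cd_join_def lo hi Suc.IH algebra_simps)
  next
    case 2
    show ?case
      by (auto simp: fun_eq_iff cd_join_def lo hi cd_conj_linear Suc.IH algebra_simps)
  }
qed

lemma cayley_distrib:
  "(x + y) * z = x * z + y * z" "x * (y + z) = x * y + x * z"
  "(a *\<^sub>R x) * y = a *\<^sub>R (x * y)" "x * (a *\<^sub>R y) = a *\<^sub>R (x * y)"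
  for x y z :: "'r cayley"
proof -
  show "(x + y) * z = x * z + y * z"
    by transfer (use cd_mult_bilinear(1)[where a = 1 and b = 1] in simp)
  show "x * (y + z) = x * y + x * z"
    by transfer (use cd_mult_bilinear(2)[where a = 1 and b = 1] in simp)
  show "(a *\<^sub>R x) * y = a *\<^sub>R (x * y)"
    by transfer (use cd_mult_bilinear(1)[where b = 0] in simp)
  show "x * (a *\<^sub>R y) = a *\<^sub>R (x * y)"
    by transfer (use cd_mult_bilinear(2)[where b = 0] in simp)
qed

lemma cd_mult_conj:
  "(\<forall>i\<ge>2 ^ r. x i = 0) \<Longrightarrow>
    cd_mult r x (cd_conj r x) = (\<lambda>i. if i = 0 then \<Sum>j<2 ^ r. (x j)\<^sup>2 else 0)"
proof (induction r arbitrary: x)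
  case 0
  then show ?case by (auto simp: fun_eq_iff power2_eq_square)
next
  case (Suc r)
  define \<xi> \<eta> where "\<xi> = cd_lo r x" and "\<eta> = cd_hi r x"
  have supp: "\<forall>i\<ge>2 ^ r. \<xi> i = 0" "\<forall>i\<ge>2 ^ r. \<eta> i = 0"
    by (auto simp: \<xi>_def \<eta>_def cd_lo_def cd_hi_def)
  have suppc: "\<forall>i\<ge>2 ^ r. cd_conj r \<xi> i = 0" "\<forall>i\<ge>2 ^ r. cd_conj r \<eta> i = 0"
    using supp cd_conj_support by blast+
  have inv: "cd_conj r (cd_conj r \<xi>) = \<xi>" "cd_conj r (cd_conj r \<eta>) = \<eta>"
    using cd_conj_coeff[OF supp(1)] cd_conj_coeff[OF supp(2)]
      cd_conj_coeff[OF suppc(1)] cd_conj_coeff[OF suppc(2)] by auto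
  have lo: "cd_lo r (cd_conj (Suc r) x) = cd_conj r \<xi>"
    using suppc by (auto simp: fun_eq_iff cd_lo_def cd_join_def \<xi>_def)
  have hi: "cd_hi r (cd_conj (Suc r) x) = (\<lambda>i. - \<eta> i)"
    using supp by (auto simp: fun_eq_iff cd_hi_def cd_join_def \<eta>_def)
  have cneg: "cd_conj r (\<lambda>i. - \<eta> i) = (\<lambda>i. - cd_conj r \<eta> i)"
    using cd_conj_linear[of r "-1" \<eta> 0 \<eta>] by simp
  have mneg: "cd_mult r (\<lambda>i. - u i) v = (\<lambda>i. - cd_mult r u v i)" for u v
    using cd_mult_bilinear(1)[of r "-1" u 0 u] by simp
  have "cd_mult r (cd_conj r \<eta>) \<eta> = (\<lambda>i. if i = 0 then \<Sum>j<2 ^ r. (cd_conj r \<eta> j)\<^sup>2 else 0)"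
    using Suc.IH[OF suppc(2)] by (simp add: inv)
  also have "(\<Sum>j<2 ^ r. (cd_conj r \<eta> j)\<^sup>2) = (\<Sum>j<2 ^ r. (\<eta> j)\<^sup>2)"
    by (rule sum.cong) (auto simp: cd_conj_coeff[OF supp(2)])
  finally have 2: "cd_mult r (cd_conj r \<eta>) \<eta> = (\<lambda>i. if i = 0 then \<Sum>j<2 ^ r. (\<eta> j)\<^sup>2 else 0)" .
  have "(\<Sum>j<2 ^ Suc r. (x j)\<^sup>2) = (\<Sum>j<2 ^ r. (x j)\<^sup>2) + (\<Sum>j=2 ^ r..<2 ^ r + 2 ^ r. (x j)\<^sup>2)"
    by (simp add: lessThan_atLeast0 sum.atLeastLessThan_concat mult_2)
  also have "(\<Sum>j=2 ^ r..<2 ^ r + 2 ^ r. (x j)\<^sup>2) = (\<Sum>j<2 ^ r. (x (2 ^ r + j))\<^sup>2)"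
    using sum.shift_bounds_nat_ivl[of "\<lambda>j. (x j)\<^sup>2" 0 "2 ^ r" "2 ^ r"]
    by (simp add: lessThan_atLeast0 add.commute)
  finally have S: "(\<Sum>j<2 ^ Suc r. (x j)\<^sup>2) = (\<Sum>j<2 ^ r. (\<xi> j)\<^sup>2) + (\<Sum>j<2 ^ r. (\<eta> j)\<^sup>2)"
    by (simp add: \<xi>_def \<eta>_def cd_lo_def cd_hi_def)
  show ?case
    unfolding cd_mult.simps lo hi \<xi>_def[symmetric] \<eta>_def[symmetric] cneg mneg inv
      Suc.IH[OF supp(1)] 2 S
    by (auto simp: fun_eq_iff cd_join_def)
qed

lemma cayley_mult_cnj: "x * cayley_cnj x = (norm x)\<^sup>2 *\<^sub>R 1" for x :: "'r cayley"
proof (rule cayley_eqI)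
  have "(norm x)\<^sup>2 = (\<Sum>j<2 ^ CARD('r). (cd_coeff x j)\<^sup>2)"
    unfolding power2_norm_eq_inner inner_cayley_def by (simp add: power2_eq_square)
  moreover have "cd_coeff (x * cayley_cnj x) i =
      (if i = 0 then \<Sum>j<2 ^ CARD('r). (cd_coeff x j)\<^sup>2 else 0)" for i
    by transfer (simp add: cd_mult_conj)
  ultimately show "cd_coeff (x * cayley_cnj x) i = cd_coeff ((norm x)\<^sup>2 *\<^sub>R 1) i" for i
    by simp
qed

lemma cnj_cbasis: "j > 0 \<Longrightarrow> cayley_cnj (cbasis j) = - cbasis j"
  by (rule cayley_eqI) (auto simp: cd_coeff_cnj cd_coeff_cbasis)

lemma cbasis_relations:
  fixes j k :: nat
  assumes "0 < j" "j < 2 ^ CARD('r)"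
  shows "cbasis j * cbasis j = (- 1 :: 'r cayley)"
    and "0 < k \<Longrightarrow> k < 2 ^ CARD('r) \<Longrightarrow> j \<noteq> k \<Longrightarrow>
      cbasis j * cbasis k = (- (cbasis k * cbasis j) :: 'r cayley)"
proof -
  have neg: "x * (- y) = - (x * y)" for x y :: "'r cayley"
    using cayley_distrib(4)[of x "- 1" y] by simp
  have sq: "cbasis i * cbasis i = (- 1 :: 'r cayley)" if "0 < i" "i < 2 ^ CARD('r)" for i
  proof -
    have "inner (cbasis i :: 'r cayley) (cbasis i) = 1"
      using that by (simp add: inner_cbasis cd_coeff_cbasis)
    then have "cbasis i * cayley_cnj (cbasis i) = (1 :: 'r cayley)"
      by (simp add: cayley_mult_cnj power2_norm_eq_inner)
    then have "- (cbasis i * cbasis i) = (1 :: 'r cayley)"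
      using that by (simp only: cnj_cbasis neg)
    then show ?thesis by (metis minus_minus)
  qed
  show "cbasis j * cbasis j = (- 1 :: 'r cayley)"
    using assms by (rule sq)
  assume k: "0 < k" "k < 2 ^ CARD('r)" "j \<noteq> k"
  let ?s = "cbasis j + cbasis k :: 'r cayley"
  have "inner ?s ?s = 2"
    using assms k by (simp add: inner_add_right inner_cbasis cd_coeff_cbasis)
  moreover have "cayley_cnj ?s = - ?s"
    using assms k by (intro cayley_eqI) (auto simp: cd_coeff_cnj cd_coeff_cbasis)
  ultimately have "- (?s * ?s) = 2 *\<^sub>R 1"
    using cayley_mult_cnj[of ?s] by (simp only: neg power2_norm_eq_inner)
  then have "?s * ?s = - (2 *\<^sub>R 1)"
    by (metis minus_minus)
  moreover have "?s * ?s = cbasis j * cbasis j + cbasis k * cbasis k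
      + (cbasis j * cbasis k + cbasis k * cbasis j)"
    by (simp add: cayley_distrib(1,2) add_ac)
  ultimately have "cbasis j * cbasis k + cbasis k * cbasis j = (0 :: 'r cayley)"
    using assms k by (simp add: sq scaleR_2)
  then show "cbasis j * cbasis k = (- (cbasis k * cbasis j) :: 'r cayley)"
    by (simp add: eq_neg_iff_add_eq_0)
qed

definition cayley_Re :: "'r cayley \<Rightarrow> real" where
  "cayley_Re z = cd_coeff ((1 / 2) *\<^sub>R (z + cayley_cnj z)) 0"

lemma cayley_Re_eq: "cayley_Re z *\<^sub>R 1 = (1 / 2) *\<^sub>R (z + cayley_cnj z)"
  by (rule cayley_eqI) (simp add: cayley_Re_def cd_coeff_cnj)

definition cayley_exp :: "'r cayley \<Rightarrow> 'r cayley" where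
  "cayley_exp z = (\<Sum>k. z ^ k /\<^sub>R fact k)"


section \<open>Originals\<close>

definition slice :: "(real ^ 'n::finite \<Rightarrow> 'b) \<Rightarrow> real ^ 'n \<Rightarrow> 'n \<Rightarrow> real \<Rightarrow> 'b" where
  "slice f t j = (\<lambda>x. f (\<chi> k. if k = j then x else t $ k))"

definition discont_first_kind :: "(real \<Rightarrow> 'b::t2_space) \<Rightarrow> real \<Rightarrow> bool" where
  "discont_first_kind g x \<longleftrightarrow>
    \<not> isCont g x \<and> (\<exists>l. (g \<longlongrightarrow> l) (at_left x)) \<and> (\<exists>l. (g \<longlongrightarrow> l) (at_right x))"

text \<open>
  In the Hoelder condition the constants may depend on the whole point \<open>t\<close>; it is demanded
  where the partial function is continuous, all its discontinuities being of the first kind.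
\<close>

definition original :: "real \<Rightarrow> real \<Rightarrow> (real ^ 'n::finite \<Rightarrow> 'r cayley) \<Rightarrow> bool" where
  "original a1 am1 f \<longleftrightarrow>
    (AE t in lebesgue. isCont f t) \<and>
    (\<forall>t j a b. finite {x \<in> {a..b}. \<not> isCont (slice f t j) x} \<and>
      (\<forall>x. \<not> isCont (slice f t j) x \<longrightarrow> discont_first_kind (slice f t j) x)) \<and>
    (\<forall>t j. \<not> discont_first_kind (slice f t j) (t $ j) \<longrightarrow>
      (\<exists>A \<alpha> \<delta>. 0 < A \<and> 0 < \<alpha> \<and> \<alpha> \<le> 1 \<and> 0 < \<delta> \<and>
        (\<forall>h. \<bar>h\<bar> < \<delta> \<longrightarrow>
          norm (slice f t j (t $ j + h) - slice f t j (t $ j)) \<le> A * \<bar>h\<bar> powr \<alpha>))) \<and>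
    (\<forall>v :: 'n \<Rightarrow> real. (\<forall>j. v j \<in> {- 1, 1}) \<longrightarrow>
      (\<exists>C>0. \<forall>t. (\<forall>j. v j * t $ j \<ge> 0) \<longrightarrow>
        norm (f t) < C * exp (\<Sum>j\<in>UNIV. (if v j = 1 then a1 else am1) * t $ j)))"

definition orthant :: "(real ^ 'n) set" where
  "orthant = {t. \<forall>k. 0 \<le> t $ k}"

definition restrict_orthant :: "(real ^ 'n \<Rightarrow> 'r cayley) \<Rightarrow> real ^ 'n \<Rightarrow> 'r cayley" where
  "restrict_orthant f = (\<lambda>t. indicator orthant t *\<^sub>R f t)"

text \<open>
  The integral of \<open>f\<close> over \<open>[0, t\<^sub>1] \<times> \<dots> \<times> [0, t\<^sub>n]\<close>. For \<open>t\<close> outside the orthant the box is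
  empty here; the primitive is only used after multiplication by the characteristic function of the
  orthant.
\<close>

definition primitive :: "(real ^ 'n::finite \<Rightarrow> 'r cayley) \<Rightarrow> real ^ 'n::finite \<Rightarrow> 'r cayley" where
  "primitive f t = (LINT x:cbox 0 t|lebesgue. f x)"


section \<open>Kernels and the transform\<close>

text \<open>
  The coordinates of \<open>t\<close> are numbered \<open>1, \<dots>, n\<close> in the order of the index type and are
  continued by 0.
\<close>

definition tcoord :: "real ^ 'n::{finite,linorder} \<Rightarrow> nat \<Rightarrow> real" where
  "tcoord t j = (if 1 \<le> j \<and> j \<le> CARD('n) then t $ (sorted_list_of_set UNIV ! (j - 1)) else 0)"

definition vanishes_above :: "nat \<Rightarrow> 'r cayley \<Rightarrow> bool" where
  "vanishes_above n z \<longleftrightarrow> (\<forall>m>n. cd_coeff z m = 0)"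

datatype kernel = Spherical | Cartesian

definition cartesian_kernel ::
  "'r cayley \<Rightarrow> real ^ 'n::{finite,linorder} \<Rightarrow> 'r cayley \<Rightarrow> 'r cayley" where
  "cartesian_kernel p t \<zeta> =
    (cd_coeff p 0 * (\<Sum>j=1..CARD('n). tcoord t j)) *\<^sub>R 1
    + (\<Sum>j=1..CARD('n). (cd_coeff p j * tcoord t j) *\<^sub>R cbasis j) + \<zeta>"

definition tail_sum :: "real ^ 'n::{finite,linorder} \<Rightarrow> nat \<Rightarrow> real" where
  "tail_sum t j = (\<Sum>k=j..CARD('n). tcoord t k)"

definition phase ::
  "'r cayley \<Rightarrow> real ^ 'n::{finite,linorder} \<Rightarrow> 'r cayley \<Rightarrow> nat \<Rightarrow> real" where
  "phase p t \<zeta> j = cd_coeff p j * tail_sum t j + cd_coeff \<zeta> j"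

text \<open>The factor \<open>cos \<phi>\<^bsub>j+1\<^esub>\<close> is missing from the last term \<open>j = K = 2^r - 1\<close>.\<close>

definition spherical_kernel ::
  "'r cayley \<Rightarrow> real ^ 'n::{finite,linorder} \<Rightarrow> 'r cayley \<Rightarrow> 'r cayley" where
  "spherical_kernel p t \<zeta> =
    (let K = 2 ^ CARD('r) - 1; \<phi> = phase p t \<zeta> in
      (cd_coeff p 0 * tail_sum t 1) *\<^sub>R 1
      + \<phi> 1 *\<^sub>R (\<Sum>j=1..K.
          ((\<Prod>m=2..j. sin (\<phi> m)) * (if j < K then cos (\<phi> (j + 1)) else 1)) *\<^sub>R cbasis j)
      + cd_coeff \<zeta> 0 *\<^sub>R 1)"

primrec kernel_fun ::
  "kernel \<Rightarrow> 'r cayley \<Rightarrow> real ^ 'n::{finite,linorder} \<Rightarrow> 'r cayley \<Rightarrow> 'r cayley" where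
  "kernel_fun Spherical = spherical_kernel"
| "kernel_fun Cartesian = cartesian_kernel"

definition transform_integrand ::
  "(real ^ 'n::{finite,linorder} \<Rightarrow> 'r cayley) \<Rightarrow> kernel \<Rightarrow> 'r cayley \<Rightarrow> 'r cayley \<Rightarrow>
    real ^ 'n::{finite,linorder} \<Rightarrow> 'r cayley" where
  "transform_integrand f u p \<zeta> = (\<lambda>t. f t * cayley_exp (- kernel_fun u p t \<zeta>))"

text \<open>
  The measure is \<open>lebesgue\<close> rather than \<open>lborel\<close>: an almost everywhere continuous function is
  Lebesgue measurable, but need not be Borel measurable.
\<close>

definition transform ::
  "(real ^ 'n::{finite,linorder} \<Rightarrow> 'r cayley) \<Rightarrow> kernel \<Rightarrow> 'r cayley \<Rightarrow> 'r cayley \<Rightarrow> 'r cayley"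
where
  "transform f u p \<zeta> = (LINT t|lebesgue. transform_integrand f u p \<zeta> t)"


section \<open>The operators\<close>

definition S_op :: "nat \<Rightarrow> ('r cayley \<Rightarrow> 'r cayley) \<Rightarrow> 'r cayley \<Rightarrow> 'r cayley" where
  "S_op k F \<zeta> = - vector_derivative (\<lambda>h. F (\<zeta> + h *\<^sub>R cbasis k)) (at 0)"

primrec R_op :: "kernel \<Rightarrow> 'r cayley \<Rightarrow> nat \<Rightarrow> ('r cayley \<Rightarrow> 'r cayley) \<Rightarrow> 'r cayley \<Rightarrow> 'r cayley"
where
  "R_op Spherical p k F =
    (\<lambda>\<zeta>. cd_coeff p 0 *\<^sub>R F \<zeta> + (\<Sum>j=1..k. cd_coeff p j *\<^sub>R S_op j F \<zeta>))"
| "R_op Cartesian p k F =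
    (\<lambda>\<zeta>. cd_coeff p 0 *\<^sub>R F \<zeta> + cd_coeff p k *\<^sub>R S_op k F \<zeta>)"

text \<open>\<open>R\<^sub>k R\<^bsub>k+1\<^esub> \<dots> R\<^sub>n F\<close>; the rightmost operator acts first.\<close>

definition R_comp ::
  "kernel \<Rightarrow> 'r cayley \<Rightarrow> nat \<Rightarrow> nat \<Rightarrow> ('r cayley \<Rightarrow> 'r cayley) \<Rightarrow> 'r cayley \<Rightarrow> 'r cayley" where
  "R_comp u p k n F = foldr (R_op u p) [k..<Suc n] F"

text \<open>
  Existence of the partial derivatives that occur in \<open>R\<^sub>k F\<close>, needed because \<open>vector_derivative\<close>
  is an arbitrary value where there is no derivative.
\<close>

primrec R_directions :: "kernel \<Rightarrow> nat \<Rightarrow> nat set" where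
  "R_directions Spherical k = {1..k}"
| "R_directions Cartesian k = {k}"

definition R_applicable :: "kernel \<Rightarrow> nat \<Rightarrow> nat \<Rightarrow> ('r cayley \<Rightarrow> 'r cayley) \<Rightarrow> bool" where
  "R_applicable u n k F \<longleftrightarrow>
    (\<forall>j\<in>R_directions u k. \<forall>\<zeta>. vanishes_above n \<zeta> \<longrightarrow>
      (\<lambda>h. F (\<zeta> + h *\<^sub>R cbasis j)) differentiable (at (0 :: real)))"

end

theory Submission
  imports Defs
begin

text \<open>
  For both kernels \<open>exp (- u(p, t; \<zeta>))\<close> has the form \<open>exp (- \<zeta>\<^sub>0 - p\<^sub>0 s) \<psi> (Y t + \<zeta>)\<close> with
  \<open>s = t\<^sub>1 + \<dots> + t\<^sub>n\<close>, a linear map \<open>Y\<close>, and a function \<open>\<psi>\<close> of the imaginary part all of whose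
  derivatives grow subexponentially. The direction in which \<open>R\<^sub>k\<close> differentiates in \<open>\<zeta>\<close> is the image
  under \<open>Y\<close> of the \<open>k\<close>-th coordinate vector, so that \<open>R\<^sub>k exp (- u) = - \<partial> exp (- u) / \<partial>t\<^sub>k\<close>.
  Hence \<open>exp (- u)\<close> at \<open>t\<close> is the integral of \<open>R\<^sub>1 \<dots> R\<^sub>n exp (- u)\<close> over all \<open>x \<ge> t\<close>; inserting this
  into the transform of \<open>f\<close> and exchanging the integrals produces the primitive of \<open>f\<close>, and
  dominated convergence moves the operators out of the integral.
\<close>

section \<open>Functions with subexponential derivatives\<close>

text \<open>The domain \<open>Re p > max a1 0\<close> leaves a gap between the growth rate b of f
  and the decay rate a of exp (- p_0 s). The estimates spend fractions of this gap: on the growth of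
  \<psi>, on integrability over the orthant, on the volume of the box in the primitive. Hence the
  growth condition on \<psi> demands a bound for every rate \<epsilon>, chosen once the gap is
  known. Plain boundedness would be awkward for the Cartesian kernel: smoothness at 0 forces \<psi>
  to be written through the squared norm of the imaginary part, and the chain rule then produces
  polynomial factors.

  Non-associativity does no harm: f (t) multiplies once from the left, the operators have real
  coefficients, and the powers of one element stay in a plane. The factor exp (- \<zeta>_0) is
  carried along unchanged, since all directions of differentiation have positive index.

  An almost everywhere continuous f is only Lebesgue measurable. It is replaced by a Borel function
  that obeys the growth bound everywhere and vanishes outside the orthant, so that the integrals can
  be exchanged over \<open>lborel\<close>.\<close>

definition subexponential :: "('a::real_normed_vector \<Rightarrow> 'b::real_normed_vector) \<Rightarrow> bool" where
  "subexponential \<psi> \<longleftrightarrow> (\<forall>\<epsilon>>0. \<exists>C. \<forall>y. norm (\<psi> y) \<le> C * exp (\<epsilon> * norm y))"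

text \<open>Derivatives enter through \<open>\<psi>' y v\<close> with v fixed, so that the recursion
  never leaves functions of one type. Continuity at level 0 supplies the measurability of the
  integrands.\<close>

primrec tempered :: "nat \<Rightarrow> ('a::euclidean_space \<Rightarrow> 'b::euclidean_space) \<Rightarrow> bool" where
  "tempered 0 \<psi> \<longleftrightarrow> continuous_on UNIV \<psi> \<and> subexponential \<psi>"
| "tempered (Suc m) \<psi> \<longleftrightarrow> subexponential \<psi> \<and>
    (\<exists>\<psi>'. (\<forall>y. (\<psi> has_derivative \<psi>' y) (at y)) \<and> (\<forall>v. tempered m (\<lambda>y. \<psi>' y v)))"

lemma tempered_subexponential: "tempered m \<psi> \<Longrightarrow> subexponential \<psi>"
  by (cases m) (auto simp: tempered.simps)

lemma tempered_0I: "tempered m \<psi> \<Longrightarrow> tempered 0 \<psi>"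
  by (cases m) (auto intro!: continuous_at_imp_continuous_on dest: has_derivative_continuous)

lemma tempered_SucI:
  assumes "subexponential \<psi>" "\<And>y. (\<psi> has_derivative \<psi>' y) (at y)"
    "\<And>v. tempered m (\<lambda>y. \<psi>' y v)"
  shows "tempered (Suc m) \<psi>"
  using assms by auto

lemma tempered_derivative:
  "tempered (Suc m) \<psi> \<Longrightarrow>
    \<exists>\<psi>'. (\<forall>y. (\<psi> has_derivative \<psi>' y) (at y)) \<and> (\<forall>v. tempered m (\<lambda>y. \<psi>' y v))"
  by simp

declare tempered.simps(2) [simp del]

lemma tempered_SucD: "tempered (Suc m) \<psi> \<Longrightarrow> tempered m \<psi>"
proof (induction m arbitrary: \<psi>)
  case 0
  then show ?case by (rule tempered_0I)
next
  case (Suc m)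
  obtain \<psi>' where "\<And>y. (\<psi> has_derivative \<psi>' y) (at y)" "\<And>v. tempered (Suc m) (\<lambda>y. \<psi>' y v)"
    using tempered_derivative[OF Suc.prems] by blast
  then show ?case
    using Suc by (intro tempered_SucI) (auto dest: tempered_subexponential)
qed

lemma tempered_continuous: "tempered m \<psi> \<Longrightarrow> continuous_on UNIV \<psi>"
  using tempered_0I by auto

section \<open>Closure properties of the growth classes\<close>

lemma subexponential_bounded:
  assumes "\<And>y. norm (\<psi> y) \<le> C"
  shows "subexponential \<psi>"
  unfolding subexponential_def
proof (intro allI impI exI)
  fix \<epsilon> :: real and y assume "\<epsilon> > 0"
  have "norm (\<psi> y) \<le> \<bar>C\<bar> * 1" using assms[of y] by simp
  also have "\<dots> \<le> \<bar>C\<bar> * exp (\<epsilon> * norm y)"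
    using \<open>\<epsilon> > 0\<close> by (intro mult_left_mono) auto
  finally show "norm (\<psi> y) \<le> \<bar>C\<bar> * exp (\<epsilon> * norm y)" .
qed

lemma subexponential_add:
  assumes "subexponential f" "subexponential g"
  shows "subexponential (\<lambda>y. f y + g y)"
  unfolding subexponential_def
proof (intro allI impI)
  fix \<epsilon> :: real assume "\<epsilon> > 0"
  then obtain C D where "\<And>y. norm (f y) \<le> C * exp (\<epsilon> * norm y)" "\<And>y. norm (g y) \<le> D * exp (\<epsilon> * norm y)"
    using assms unfolding subexponential_def by blast
  then have "norm (f y + g y) \<le> (C + D) * exp (\<epsilon> * norm y)" for y
    using norm_triangle_ineq[of "f y" "g y"] by (simp add: distrib_right) (meson add_mono order_trans)
  then show "\<exists>C. \<forall>y. norm (f y + g y) \<le> C * exp (\<epsilon> * norm y)" by blast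
qed

text \<open>Each factor gets half of the rate \<epsilon>; a bound at a single fixed rate would not
  be closed under products.\<close>

lemma subexponential_bilinear:
  assumes "bounded_bilinear mul" "subexponential f" "subexponential g"
  shows "subexponential (\<lambda>y. mul (f y) (g y))"
  unfolding subexponential_def
proof (intro allI impI)
  interpret bounded_bilinear mul by fact
  fix \<epsilon> :: real assume "\<epsilon> > 0"
  then obtain C D where C: "\<And>y. norm (f y) \<le> C * exp (\<epsilon> / 2 * norm y)"
      and D: "\<And>y. norm (g y) \<le> D * exp (\<epsilon> / 2 * norm y)"
    using assms(2,3) unfolding subexponential_def by (meson half_gt_zero)
  obtain K where K: "K > 0" "\<And>a b. norm (mul a b) \<le> norm a * norm b * K"
    using pos_bounded by blast
  have "norm (mul (f y) (g y)) \<le> (C * D * K) * exp (\<epsilon> * norm y)" for y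
  proof -
    have "C * exp (\<epsilon> / 2 * norm y) \<ge> 0"
      using C[of y] norm_ge_zero order_trans by blast
    then have "norm (f y) * norm (g y) \<le> (C * exp (\<epsilon> / 2 * norm y)) * (D * exp (\<epsilon> / 2 * norm y))"
      by (intro mult_mono C D) auto
    then have "norm (f y) * norm (g y) * K \<le> (C * exp (\<epsilon> / 2 * norm y)) * (D * exp (\<epsilon> / 2 * norm y)) * K"
      using K(1) by (intro mult_right_mono) auto
    also have "\<dots> = (C * D * K) * (exp (\<epsilon> / 2 * norm y) * exp (\<epsilon> / 2 * norm y))"
      by (simp add: algebra_simps)
    also have "exp (\<epsilon> / 2 * norm y) * exp (\<epsilon> / 2 * norm y) = exp (\<epsilon> * norm y)"
      by (simp flip: exp_add)
    finally show ?thesis using K(2) order_trans by blast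
  qed
  then show "\<exists>C. \<forall>y. norm (mul (f y) (g y)) \<le> C * exp (\<epsilon> * norm y)" by blast
qed

lemma subexponential_linear:
  assumes "bounded_linear f"
  shows "subexponential f"
  unfolding subexponential_def
proof (intro allI impI)
  fix \<epsilon> :: real assume "\<epsilon> > 0"
  obtain K where K: "K > 0" "\<And>x. norm (f x) \<le> norm x * K"
    using bounded_linear.pos_bounded[OF assms] by blast
  have "norm (f y) \<le> (K / \<epsilon>) * exp (\<epsilon> * norm y)" for y
  proof -
    have "\<epsilon> * norm y \<le> exp (\<epsilon> * norm y)"
      using exp_ge_add_one_self[of "\<epsilon> * norm y"] by linarith
    then have "(K / \<epsilon>) * (\<epsilon> * norm y) \<le> (K / \<epsilon>) * exp (\<epsilon> * norm y)"
      using K(1) \<open>\<epsilon> > 0\<close> by (intro mult_left_mono) auto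
    then show ?thesis using K(2)[of y] \<open>\<epsilon> > 0\<close> by (simp add: mult.commute)
  qed
  then show "\<exists>C. \<forall>y. norm (f y) \<le> C * exp (\<epsilon> * norm y)" by blast
qed

lemma tempered_const: "tempered m (\<lambda>_. c)"
proof (induction m arbitrary: c)
  case 0
  then show ?case by (auto intro: subexponential_bounded[of _ "norm c"])
next
  case (Suc m)
  show ?case
    by (rule tempered_SucI[of _ "\<lambda>_ _. 0"]) (auto intro: subexponential_bounded[of _ "norm c"] Suc.IH)
qed

lemma tempered_add:
  "tempered m f \<Longrightarrow> tempered m g \<Longrightarrow> tempered m (\<lambda>y. f y + g y)"
proof (induction m arbitrary: f g)
  case 0
  then show ?case by (auto intro: subexponential_add continuous_on_add)
next
  case (Suc m)
  obtain f' where f': "\<And>y. (f has_derivative f' y) (at y)" "\<And>v. tempered m (\<lambda>y. f' y v)"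
    using tempered_derivative[OF Suc.prems(1)] by blast
  obtain g' where g': "\<And>y. (g has_derivative g' y) (at y)" "\<And>v. tempered m (\<lambda>y. g' y v)"
    using tempered_derivative[OF Suc.prems(2)] by blast
  show ?case
    by (rule tempered_SucI[of _ "\<lambda>y v. f' y v + g' y v"])
      (use Suc f' g' in \<open>auto intro: subexponential_add tempered_subexponential has_derivative_add
        simp del: tempered.simps\<close>)
qed

lemma tempered_bilinear:
  fixes mul :: "'b::euclidean_space \<Rightarrow> 'c::euclidean_space \<Rightarrow> 'd::euclidean_space"
  assumes "bounded_bilinear mul"
  shows "tempered m f \<Longrightarrow> tempered m g \<Longrightarrow> tempered m (\<lambda>y. mul (f y) (g y))"
proof (induction m arbitrary: f g)
  case 0
  then show ?case
    by (auto intro: subexponential_bilinear[OF assms] bounded_bilinear.continuous_on[OF assms])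
next
  case (Suc m)
  obtain f' where f': "\<And>y. (f has_derivative f' y) (at y)" "\<And>v. tempered m (\<lambda>y. f' y v)"
    using tempered_derivative[OF Suc.prems(1)] by blast
  obtain g' where g': "\<And>y. (g has_derivative g' y) (at y)" "\<And>v. tempered m (\<lambda>y. g' y v)"
    using tempered_derivative[OF Suc.prems(2)] by blast
  \<comment> \<open>The product rule leaves one factor undifferentiated, so both are also needed at
    the lower level.\<close>
  have sub: "tempered m f" "tempered m g"
    using Suc.prems by (blast intro: tempered_SucD)+
  show ?case
  proof (rule tempered_SucI)
    show "subexponential (\<lambda>y. mul (f y) (g y))"
      using Suc.prems by (blast intro: subexponential_bilinear[OF assms] tempered_subexponential)
    show "((\<lambda>y. mul (f y) (g y)) has_derivative (\<lambda>v. mul (f y) (g' y v) + mul (f' y v) (g y))) (at y)" for y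
      by (rule bounded_bilinear.FDERIV[OF assms f'(1) g'(1)])
    show "tempered m (\<lambda>y. mul (f y) (g' y v) + mul (f' y v) (g y))" for v
      using f'(2) g'(2) sub by (intro tempered_add Suc.IH)
  qed
qed

lemmas tempered_mult = tempered_bilinear[OF bounded_bilinear_mult]
lemmas tempered_scaleR = tempered_bilinear[OF bounded_bilinear_scaleR]

lemma tempered_minus: "tempered m f \<Longrightarrow> tempered m (\<lambda>y. - f y)"
  using tempered_scaleR[OF tempered_const[of m "-1"]] by simp

lemma tempered_diff: "tempered m f \<Longrightarrow> tempered m g \<Longrightarrow> tempered m (\<lambda>y. f y - g y)"
  using tempered_add[OF _ tempered_minus] by fastforce

lemma tempered_sum: "(\<And>i. i \<in> A \<Longrightarrow> tempered m (f i)) \<Longrightarrow> tempered m (\<lambda>y. \<Sum>i\<in>A. f i y)"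
  by (induction A rule: infinite_finite_induct) (auto simp del: tempered.simps intro: tempered_const tempered_add)

lemma tempered_prod:
  fixes f :: "'i \<Rightarrow> 'a::euclidean_space \<Rightarrow> real"
  shows "(\<And>i. i \<in> A \<Longrightarrow> tempered m (f i)) \<Longrightarrow> tempered m (\<lambda>y. \<Prod>i\<in>A. f i y)"
  by (induction A rule: infinite_finite_induct) (auto simp del: tempered.simps intro: tempered_const tempered_mult)

lemma tempered_linear:
  assumes "bounded_linear f"
  shows "tempered m f"
proof (cases m)
  case 0
  then show ?thesis
    using assms by (simp add: subexponential_linear linear_continuous_on)
next
  case (Suc m')
  show ?thesis unfolding Suc
    by (rule tempered_SucI[of _ "\<lambda>_. f"])
      (auto intro: subexponential_linear[OF assms] bounded_linear_imp_has_derivative[OF assms] tempered_const)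
qed

section \<open>Composition with cosine, sine and the derivatives of cos (sqrt q)\<close>

text \<open>Applied to \<open>F j x = cos (x + j \<pi> / 2)\<close> and to the derivatives of \<open>cos (sqrt q)\<close>.\<close>

lemma tempered_compose:
  fixes F :: "nat \<Rightarrow> real \<Rightarrow> real" and q :: "'a::euclidean_space \<Rightarrow> real"
  assumes F: "\<And>j x. (F j has_real_derivative F (Suc j) x) (at x)"
    and bound: "\<And>j y. \<bar>F j (q y)\<bar> \<le> B j"
    and q: "\<And>m. tempered m q"
  shows "tempered m (\<lambda>y. F j (q y))"
proof (induction m arbitrary: j)
  case 0
  have "continuous_on UNIV (F j)"
    using F by (intro continuous_at_imp_continuous_on) (auto intro: DERIV_isCont)
  moreover have "continuous_on UNIV q"
    using q tempered_continuous by blast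
  ultimately show ?case
    using bound by (auto intro!: subexponential_bounded[of _ "B j"] continuous_on_compose2[of UNIV "F j" UNIV q])
next
  case (Suc m)
  obtain q' where q': "\<And>y. (q has_derivative q' y) (at y)" "\<And>v. tempered m (\<lambda>y. q' y v)"
    using tempered_derivative[OF q] by blast
  show ?case
  proof (rule tempered_SucI)
    show "subexponential (\<lambda>y. F j (q y))"
      using bound by (auto intro!: subexponential_bounded[of _ "B j"])
    show "((\<lambda>y. F j (q y)) has_derivative (\<lambda>v. q' y v * F (Suc j) (q y))) (at y)" for y
      using has_derivative_compose[OF q'(1)[of y] F[of j "q y", unfolded has_field_derivative_def]]
      by (simp add: mult.commute)
    show "tempered m (\<lambda>y. q' y v * F (Suc j) (q y))" for v
      by (intro tempered_mult q' Suc.IH)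
  qed
qed

lemma tempered_cos_sin:
  fixes q :: "'a::euclidean_space \<Rightarrow> real"
  assumes q: "\<And>m. tempered m q"
  shows "tempered m (\<lambda>y. cos (q y))" "tempered m (\<lambda>y. sin (q y))"
proof -
  \<comment> \<open>Differentiating the cosine shifts its argument by \<pi> / 2, so this sequence is
    closed under differentiation; the sine is minus its member 1.\<close>
  define F :: "nat \<Rightarrow> real \<Rightarrow> real" where "F j x = cos (x + of_nat j * (pi / 2))" for j x
  have "(F j has_real_derivative F (Suc j) x) (at x)" for j x
  proof -
    have "F (Suc j) x = - sin (x + of_nat j * (pi / 2))"
      by (simp add: F_def minus_sin_cos_eq distrib_right add_divide_distrib algebra_simps)
    then show ?thesis
      unfolding F_def by (auto intro!: derivative_eq_intros)
  qed
  then have *: "tempered m (\<lambda>y. F j (q y))" for j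
    by (rule tempered_compose[of F q "\<lambda>_. 1"]) (auto simp: F_def q simp del: tempered.simps)
  show "tempered m (\<lambda>y. cos (q y))"
    using *[of 0] by (simp add: F_def del: tempered.simps)
  show "tempered m (\<lambda>y. sin (q y))"
    using tempered_minus[OF *[of 1]] by (simp add: F_def cos_add del: tempered.simps)
qed

text \<open>The j-th derivative of the entire function that equals cos (sqrt q) for q \<ge> 0. The
  power series is used because sqrt is not differentiable at 0, and q = 0 is attained where the
  imaginary part vanishes.\<close>

definition cos_sqrt_deriv :: "nat \<Rightarrow> real \<Rightarrow> real" where
  "cos_sqrt_deriv j q = (\<Sum>n. (diffs ^^ j) (\<lambda>n. (- 1) ^ n / fact (2 * n)) n * q ^ n)"

lemma summable_cos_sqrt_deriv:
  "summable (\<lambda>n. (diffs ^^ j) (\<lambda>n. (- 1) ^ n / fact (2 * n)) n * (q :: real) ^ n)"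
proof (induction j arbitrary: q)
  case 0
  show ?case
  proof (rule summable_comparison_test'[where g = "\<lambda>n. \<bar>q\<bar> ^ n /\<^sub>R fact n" and N = 0])
    show "summable (\<lambda>n. \<bar>q\<bar> ^ n /\<^sub>R fact n)" by (rule summable_exp_generic)
    fix n :: nat
    have "(fact n :: real) \<le> fact (2 * n)" by (rule fact_mono) simp
    then show "norm ((diffs ^^ 0) (\<lambda>n. (- 1) ^ n / fact (2 * n)) n * q ^ n) \<le> \<bar>q\<bar> ^ n /\<^sub>R fact n"
      by (simp add: abs_mult power_abs divide_inverse mult.commute[of "inverse _"] mult_left_mono le_imp_inverse_le)
  qed
next
  case (Suc j)
  show ?case
    using termdiff_converges_all[of "(diffs ^^ j) (\<lambda>n. (- 1) ^ n / fact (2 * n))" q] Suc.IH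
    by simp
qed

lemma DERIV_cos_sqrt_deriv: "(cos_sqrt_deriv j has_real_derivative cos_sqrt_deriv (Suc j) q) (at q)"
  unfolding cos_sqrt_deriv_def[abs_def]
  using termdiffs_strong_converges_everywhere[OF summable_cos_sqrt_deriv[of j]] by simp

lemma cos_sqrt_deriv_0:
  assumes "q \<ge> 0"
  shows "cos_sqrt_deriv 0 q = cos (sqrt q)"
proof -
  have "(\<lambda>n. cos_coeff (n * 2) * sqrt q ^ (n * 2)) sums cos (sqrt q)"
  proof -
    \<comment> \<open>Grouping the cosine series in pairs removes the odd terms, whose coefficients
      are 0.\<close>
    have "(\<lambda>n. \<Sum>i = n * 2..<n * 2 + 2. cos_coeff i * sqrt q ^ i) sums cos (sqrt q)"
      using sums_group[OF cos_converges[of "sqrt q", unfolded real_scaleR_def], of 2] by simp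
    moreover have "(\<Sum>i = n * 2..<n * 2 + 2. cos_coeff i * sqrt q ^ i) = cos_coeff (n * 2) * sqrt q ^ (n * 2)" for n
    proof -
      have "{n * 2..<n * 2 + 2} = {n * 2, Suc (n * 2)}" by auto
      then show ?thesis by (simp add: cos_coeff_def)
    qed
    ultimately show ?thesis by (simp only:)
  qed
  moreover have "cos_coeff (n * 2) * sqrt q ^ (n * 2) = (- 1) ^ n / fact (2 * n) * q ^ n" for n
    using assms by (simp add: cos_coeff_def mult.commute[of n] power_mult)
  ultimately show ?thesis
    by (simp add: cos_sqrt_deriv_def sums_iff)
qed

text \<open>Two computations of one derivative for q > 0. The point is that
  \<open>2 * cos_sqrt_deriv 1\<close> extends - sin x / x, as a function of q = x^2, smoothly to 0;
  this is the coefficient of the imaginary part in the Cartesian exponential.\<close>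

lemma cos_sqrt_deriv_1:
  assumes "q > 0"
  shows "2 * sqrt q * cos_sqrt_deriv 1 q = - sin (sqrt q)"
proof -
  have "((\<lambda>x. cos (sqrt x)) has_real_derivative - sin (sqrt q) * (inverse (sqrt q) / 2)) (at q)"
    using assms by (auto intro!: derivative_eq_intros)
  then have "(cos_sqrt_deriv 0 has_real_derivative - sin (sqrt q) * (inverse (sqrt q) / 2)) (at q)"
    by (rule has_field_derivative_transform_within_open[of _ _ _ "{0<..}"])
      (use assms in \<open>auto simp: cos_sqrt_deriv_0\<close>)
  from DERIV_unique[OF this DERIV_cos_sqrt_deriv] show ?thesis
    using assms by (simp add: field_simps)
qed

text \<open>The function \<open>cos (sqrt q)\<close> solves \<open>4 q C'' + 2 C' + C = 0\<close>; differentiate \<open>j\<close> times.\<close>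

lemma cos_sqrt_ode:
  assumes "q > 0"
  shows "4 * q * cos_sqrt_deriv (j + 2) q + (4 * real j + 2) * cos_sqrt_deriv (j + 1) q + cos_sqrt_deriv j q = 0"
  using assms
proof (induction j arbitrary: q)
  case 0
  \<comment> \<open>The relation 2 sqrt q C' = - sin (sqrt q) is differentiated on both sides;
    multiplying the result by 2 sqrt q clears the root.\<close>
  have "((\<lambda>x. 2 * sqrt x * cos_sqrt_deriv 1 x) has_real_derivative
      inverse (sqrt q) * cos_sqrt_deriv 1 q + 2 * sqrt q * cos_sqrt_deriv 2 q) (at q)"
    using 0 DERIV_cos_sqrt_deriv[of 1 q] by (auto intro!: derivative_eq_intros simp: numeral_2_eq_2)
  moreover have "((\<lambda>x. 2 * sqrt x * cos_sqrt_deriv 1 x) has_real_derivative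
      - (cos (sqrt q) * (inverse (sqrt q) / 2))) (at q)"
  proof (rule has_field_derivative_transform_within_open[of "\<lambda>x. - sin (sqrt x)" _ _ "{0<..}"])
    show "((\<lambda>x. - sin (sqrt x)) has_real_derivative - (cos (sqrt q) * (inverse (sqrt q) / 2))) (at q)"
      using 0 by (auto intro!: derivative_eq_intros)
  qed (use 0 cos_sqrt_deriv_1 in auto)
  ultimately have "inverse (sqrt q) * cos_sqrt_deriv 1 q + 2 * sqrt q * cos_sqrt_deriv 2 q =
      - (cos (sqrt q) * (inverse (sqrt q) / 2))"
    by (rule DERIV_unique)
  then have "2 * sqrt q * (inverse (sqrt q) * cos_sqrt_deriv 1 q + 2 * sqrt q * cos_sqrt_deriv 2 q) =
      2 * sqrt q * - (cos (sqrt q) * (inverse (sqrt q) / 2))"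
    by simp
  moreover have "2 * sqrt q * (inverse (sqrt q) * cos_sqrt_deriv 1 q + 2 * sqrt q * cos_sqrt_deriv 2 q) =
      2 * cos_sqrt_deriv 1 q + 4 * (sqrt q * sqrt q) * cos_sqrt_deriv 2 q"
    using 0 by (simp add: algebra_simps del: real_sqrt_mult_self)
  moreover have "2 * sqrt q * - (cos (sqrt q) * (inverse (sqrt q) / 2)) = - cos (sqrt q)"
    using 0 by simp
  ultimately show ?case
    using 0 by (simp add: cos_sqrt_deriv_0 numeral_2_eq_2)
next
  case (Suc j)
  have "((\<lambda>x. 4 * x * cos_sqrt_deriv (j + 2) x + (4 * real j + 2) * cos_sqrt_deriv (j + 1) x + cos_sqrt_deriv j x)
    has_real_derivative 4 * cos_sqrt_deriv (j + 2) q + 4 * q * cos_sqrt_deriv (j + 3) q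
      + (4 * real j + 2) * cos_sqrt_deriv (j + 2) q + cos_sqrt_deriv (j + 1) q) (at q)"
    using DERIV_cos_sqrt_deriv[of "j + 2" q] DERIV_cos_sqrt_deriv[of "j + 1" q] DERIV_cos_sqrt_deriv[of j q]
    by (auto intro!: derivative_eq_intros simp: eval_nat_numeral)
  moreover have "((\<lambda>x. 4 * x * cos_sqrt_deriv (j + 2) x + (4 * real j + 2) * cos_sqrt_deriv (j + 1) x + cos_sqrt_deriv j x)
    has_real_derivative 0) (at q)"
    by (rule has_field_derivative_transform_within_open[of "\<lambda>_. 0" _ _ "{0<..}"])
      (use Suc in auto)
  ultimately have "4 * cos_sqrt_deriv (j + 2) q + 4 * q * cos_sqrt_deriv (j + 3) q
      + (4 * real j + 2) * cos_sqrt_deriv (j + 2) q + cos_sqrt_deriv (j + 1) q = 0"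
    by (rule DERIV_unique)
  then show ?case by (simp add: algebra_simps eval_nat_numeral)
qed

text \<open>For q \<ge> 1 the differential equation bounds each derivative by the two before it, as
  the leading coefficient 4 q is at least 1. The equation degenerates at 0, so [0, 1] is treated by
  compactness.\<close>

lemma cos_sqrt_deriv_bounded: "\<exists>B. \<forall>q\<ge>0. \<bar>cos_sqrt_deriv j q\<bar> \<le> B"
proof -
  have far: "\<exists>B. \<forall>q\<ge>1. \<bar>cos_sqrt_deriv j q\<bar> \<le> B" for j
  proof (induction j rule: less_induct)
    case (less j)
    consider "j = 0" | "j = 1" | i where "j = i + 2"
      by (metis One_nat_def Suc_1 add_Suc_right add_eq_if add.right_neutral not0_implies_Suc)
    then show ?case
    proof cases
      case 1
      then show ?thesis by (intro exI[of _ 1]) (auto simp: cos_sqrt_deriv_0)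
    next
      case 2
      have "\<bar>cos_sqrt_deriv 1 q\<bar> \<le> 1" if "q \<ge> 1" for q
      proof -
        have "1 * \<bar>cos_sqrt_deriv 1 q\<bar> \<le> (2 * sqrt q) * \<bar>cos_sqrt_deriv 1 q\<bar>"
          using that real_sqrt_ge_one[of q] by (intro mult_right_mono) linarith+
        also have "\<dots> = \<bar>2 * sqrt q * cos_sqrt_deriv 1 q\<bar>"
          using that by (simp add: abs_mult)
        also have "\<dots> \<le> 1" using that by (simp add: cos_sqrt_deriv_1 del: One_nat_def)
        finally show ?thesis by simp
      qed
      then show ?thesis using 2 by blast
    next
      case 3
      obtain B1 B2 where B: "\<And>q. q \<ge> 1 \<Longrightarrow> \<bar>cos_sqrt_deriv (i + 1) q\<bar> \<le> B1"
          "\<And>q. q \<ge> 1 \<Longrightarrow> \<bar>cos_sqrt_deriv i q\<bar> \<le> B2"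
        using less[of i] less[of "i + 1"] 3 by auto
      have "\<bar>cos_sqrt_deriv (i + 2) q\<bar> \<le> (4 * real i + 2) * B1 + B2" if "q \<ge> 1" for q
      proof -
        have "\<bar>cos_sqrt_deriv (i + 2) q\<bar> \<le> (4 * q) * \<bar>cos_sqrt_deriv (i + 2) q\<bar>"
          using mult_right_mono[of 1 "4 * q" "\<bar>cos_sqrt_deriv (i + 2) q\<bar>"] that by simp
        also have "\<dots> = \<bar>4 * q * cos_sqrt_deriv (i + 2) q\<bar>"
          using that by (simp add: abs_mult)
        also have "\<dots> = \<bar>(4 * real i + 2) * cos_sqrt_deriv (i + 1) q + cos_sqrt_deriv i q\<bar>"
          using cos_sqrt_ode[of q i] that by linarith
        also have "\<dots> \<le> (4 * real i + 2) * \<bar>cos_sqrt_deriv (i + 1) q\<bar> + \<bar>cos_sqrt_deriv i q\<bar>"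
          by (rule order_trans[OF abs_triangle_ineq]) (simp add: abs_mult)
        also have "\<dots> \<le> (4 * real i + 2) * B1 + B2"
          using that by (intro add_mono mult_left_mono B) auto
        finally show ?thesis .
      qed
      then show ?thesis using 3 by blast
    qed
  qed
  have "continuous_on {0..1} (cos_sqrt_deriv j)"
    using DERIV_cos_sqrt_deriv by (intro continuous_at_imp_continuous_on) (auto intro: DERIV_isCont)
  then have "compact (cos_sqrt_deriv j ` {0..1})"
    by (rule compact_continuous_image) simp
  then obtain B1 where "\<forall>x\<in>cos_sqrt_deriv j ` {0..1}. norm x \<le> B1"
    using compact_imp_bounded bounded_iff by metis
  moreover obtain B2 where "\<forall>q\<ge>1. \<bar>cos_sqrt_deriv j q\<bar> \<le> B2"
    using far by blast
  ultimately have "\<forall>q\<ge>0. \<bar>cos_sqrt_deriv j q\<bar> \<le> max B1 B2"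
    by (metis atLeastAtMost_iff image_eqI linear max.coboundedI1 max.coboundedI2 real_norm_def)
  then show ?thesis by blast
qed

text \<open>The bounds hold for q \<ge> 0 only: for negative q the function is cosh (sqrt (-
  q)).\<close>

lemma tempered_cos_sqrt_deriv:
  fixes q :: "'a::euclidean_space \<Rightarrow> real"
  assumes "\<And>m. tempered m q" "\<And>y. q y \<ge> 0"
  shows "tempered m (\<lambda>y. cos_sqrt_deriv j (q y))"
proof -
  have "\<forall>j. \<exists>B. \<forall>q\<ge>0. \<bar>cos_sqrt_deriv j q\<bar> \<le> B"
    by (intro allI cos_sqrt_deriv_bounded)
  then have "\<exists>B. \<forall>j. \<forall>q\<ge>0. \<bar>cos_sqrt_deriv j q\<bar> \<le> B j"
    by (rule choice)
  then obtain B where "\<forall>j. \<forall>q\<ge>0. \<bar>cos_sqrt_deriv j q\<bar> \<le> B j" ..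
  then have "\<bar>cos_sqrt_deriv j (q y)\<bar> \<le> B j" for j y
    using assms(2) by blast
  then show ?thesis
    by (rule tempered_compose[where F = cos_sqrt_deriv and q = q and B = B, OF DERIV_cos_sqrt_deriv _ assms(1)])
qed

section \<open>Integration over the orthant\<close>

lemma set_integrable_exp_half_line:
  fixes c :: real
  assumes "c > 0"
  shows "set_integrable lborel {0<..} (\<lambda>x. exp (- (c * x)))"
proof -
  have "set_integrable lborel (einterval 0 \<infinity>) (\<lambda>x. exp (- (c * x)))"
  proof (rule interval_integral_FTC_nonneg[where F = "\<lambda>x. - exp (- (c * x)) / c" and A = "- 1 / c" and B = 0])
    show "((\<lambda>x. - exp (- (c * x)) / c) has_real_derivative exp (- (c * x))) (at x)" for x
      using assms by (auto intro!: derivative_eq_intros)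
    have "((\<lambda>x. - exp (- (c * x)) / c) \<longlongrightarrow> - exp (- (c * 0)) / c) (at_right 0)"
      using assms by (intro tendsto_intros) auto
    then show "(((\<lambda>x. - exp (- (c * x)) / c) \<circ> real_of_ereal) \<longlongrightarrow> - 1 / c) (at_right 0)"
      by (simp add: zero_ereal_def ereal_tendsto_simps)
    have "((\<lambda>x. exp (- (c * x))) \<longlongrightarrow> 0) at_top"
      using assms by (intro filterlim_compose[OF exp_at_bot] filterlim_uminus_at_bot_at_top
        filterlim_compose[OF filterlim_uminus_at_bot_at_top] filterlim_tendsto_pos_mult_at_top[OF tendsto_const])
        (auto intro: filterlim_ident)
    from tendsto_divide[OF tendsto_minus[OF this] tendsto_const, of c] assms
    show "(((\<lambda>x. - exp (- (c * x)) / c) \<circ> real_of_ereal) \<longlongrightarrow> 0) (at_left \<infinity>)"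
      by (simp add: ereal_tendsto_simps)
  qed auto
  then show ?thesis by (simp add: zero_ereal_def)
qed

text \<open>The fundamental theorem for improper integrals yields open half-lines, whereas the
  orthant is closed.\<close>

lemma AE_half_line_open: "AE x :: real in lborel. indicator {0<..} x = (indicator {0..} x :: real)"
  by (rule eventually_mono[OF AE_lborel_singleton[of "0::real"]]) (auto simp: indicator_def)

lemma integrable_exp_half_line:
  fixes c :: real
  assumes "c > 0"
  shows "integrable lborel (\<lambda>x. indicator {0..} x * exp (- (c * x)))"
proof -
  have "integrable lborel (\<lambda>x. indicator {0<..} x * exp (- (c * x)))"
    using set_integrable_exp_half_line[OF assms] by (simp add: set_integrable_def)
  then show ?thesis
    by (rule integrable_cong_AE_imp) (use AE_half_line_open in \<open>auto elim: eventually_mono\<close>)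
qed

text \<open>The one-dimensional step of the later iteration: the decay of F removes the boundary
  term at infinity, and the decay of f gives absolute convergence.\<close>

lemma integral_half_line_derivative:
  fixes F f :: "real \<Rightarrow> 'c::euclidean_space"
  assumes c: "c > 0"
    and F: "\<And>x. (F has_vector_derivative - f x) (at x)"
    and f: "continuous_on UNIV f"
    and F_bound: "\<And>x. x \<ge> 0 \<Longrightarrow> norm (F x) \<le> C * exp (- (c * x))"
    and f_bound: "\<And>x. x \<ge> 0 \<Longrightarrow> norm (f x) \<le> C * exp (- (c * x))"
  shows "(LINT x|lborel. indicator {0..} x *\<^sub>R f x) = F 0"
proof -
  have [measurable]: "f \<in> borel_measurable borel"
    using f by (rule borel_measurable_continuous_onI)
  have int: "set_integrable lborel {0<..} f"
    unfolding set_integrable_def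
  proof (rule Bochner_Integration.integrable_bound)
    show "integrable lborel (\<lambda>x. C * (indicator {0<..} x * exp (- (c * x))))"
      using set_integrable_exp_half_line[OF c] by (simp add: set_integrable_def)
    have C: "C \<ge> 0" using order_trans[OF norm_ge_zero F_bound[of 0]] by simp
    show "AE x in lborel. norm (indicator {0<..} x *\<^sub>R f x) \<le> norm (C * (indicator {0<..} x * exp (- (c * x))))"
      using f_bound C by (intro AE_I2) (auto simp: indicator_def abs_mult)
  qed measurable
  have "(LINT x|lborel. indicator {0..} x *\<^sub>R f x) = (LINT x|lborel. indicator {0<..} x *\<^sub>R f x)"
    by (rule integral_cong_AE) (use AE_half_line_open in \<open>auto elim: eventually_mono\<close>)
  also have "\<dots> = (LBINT x=0..\<infinity>. f x)"
    by (simp add: interval_lebesgue_integral_0_infty set_lebesgue_integral_def)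
  also have "\<dots> = - (LBINT x=0..\<infinity>. - f x)"
    by (simp add: interval_lebesgue_integral_0_infty set_lebesgue_integral_def)
  also have "(LBINT x=0..\<infinity>. - f x) = 0 - F 0"
  proof (rule interval_integral_FTC_integrable[where F = F])
    show "(F has_vector_derivative - f x) (at x)" for x by (rule F)
    show "isCont (\<lambda>x. - f x) x" for x
      using f by (simp add: continuous_on_eq_continuous_at)
    show "set_integrable lborel (einterval 0 \<infinity>) (\<lambda>x. - f x)"
      using int by (simp add: zero_ereal_def set_integrable_def)
    have "isCont F 0" using F has_vector_derivative_continuous by blast
    then have "(F \<longlongrightarrow> F 0) (at_right 0)"
      by (simp add: continuous_at filterlim_at_split)
    then show "((F \<circ> real_of_ereal) \<longlongrightarrow> F 0) (at_right 0)"
      by (simp add: zero_ereal_def ereal_tendsto_simps)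
    have lim: "((\<lambda>x. exp (- (c * x))) \<longlongrightarrow> 0) at_top"
      using c by (intro filterlim_compose[OF exp_at_bot] filterlim_uminus_at_bot_at_top
        filterlim_compose[OF filterlim_uminus_at_bot_at_top] filterlim_tendsto_pos_mult_at_top[OF tendsto_const])
        (auto intro: filterlim_ident)
    have "(F \<longlongrightarrow> 0) at_top"
      by (rule Lim_null_comparison[OF _ tendsto_mult_right_zero[OF lim, of C]])
        (use F_bound in \<open>auto simp: eventually_at_top_linorder intro!: exI[of _ 0]\<close>)
    then show "((F \<circ> real_of_ereal) \<longlongrightarrow> 0) (at_left \<infinity>)"
      by (simp add: ereal_tendsto_simps)
  qed simp
  finally show ?thesis by simp
qed

section \<open>The orthant and its exponential weights\<close>

definition coord_sum :: "real ^ 'n::finite \<Rightarrow> real" where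
  "coord_sum t = (\<Sum>b\<in>Basis. t \<bullet> b)"

lemma coord_sum_eq: "coord_sum t = (\<Sum>i\<in>UNIV. t $ i)"
  unfolding coord_sum_def Basis_vec_def
  by (simp add: UNION_singleton_eq_range sum.reindex inj_def axis_eq_axis inner_axis)

lemma bounded_linear_coord_sum: "bounded_linear coord_sum"
  unfolding coord_sum_def by (intro bounded_linear_sum bounded_linear_inner_left)

lemma coord_sum_measurable [measurable]: "coord_sum \<in> borel_measurable borel"
  by (intro borel_measurable_continuous_onI linear_continuous_on bounded_linear_coord_sum)

lemma coord_sum_add: "coord_sum (s + t) = coord_sum s + coord_sum t"
  by (simp add: linear_simps[OF bounded_linear_coord_sum])

lemma coord_sum_scaleR: "coord_sum (h *\<^sub>R t) = h * coord_sum t"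
  by (simp add: linear_simps[OF bounded_linear_coord_sum])

lemma coord_sum_diff: "coord_sum (s - t) = coord_sum s - coord_sum t"
  by (simp add: linear_simps[OF bounded_linear_coord_sum])

lemma coord_sum_sum: "coord_sum (\<Sum>i\<in>I. g i) = (\<Sum>i\<in>I. coord_sum (g i))"
  by (rule linear_sum[OF bounded_linear.linear[OF bounded_linear_coord_sum]])

lemma coord_sum_Basis: "b \<in> Basis \<Longrightarrow> coord_sum b = 1"
  by (simp add: coord_sum_def inner_Basis)

lemma orthant_iff: "t \<in> orthant \<longleftrightarrow> (\<forall>b\<in>Basis. 0 \<le> t \<bullet> b)"
  by (auto simp: orthant_def Basis_vec_def inner_axis)

lemma orthant_sets [measurable]: "orthant \<in> sets (borel :: (real ^ 'n::finite) measure)"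
proof -
  have "orthant = {t :: real ^ 'n. \<forall>b\<in>Basis. 0 \<le> t \<bullet> b}" by (auto simp: orthant_iff)
  also have "\<dots> \<in> sets borel" by measurable
  finally show ?thesis .
qed

lemma orthant_add: "s \<in> orthant \<Longrightarrow> t \<in> orthant \<Longrightarrow> s + t \<in> orthant"
  by (simp add: orthant_def)

lemma orthant_scaleR_Basis: "b \<in> Basis \<Longrightarrow> h \<ge> 0 \<Longrightarrow> h *\<^sub>R b \<in> orthant"
  by (auto simp: orthant_iff inner_Basis)

lemma coord_sum_nonneg: "t \<in> orthant \<Longrightarrow> coord_sum t \<ge> 0"
  by (auto simp: orthant_iff coord_sum_def intro: sum_nonneg)

text \<open>On the orthant \<open>coord_sum\<close> is the l1 norm. This turns growth in the norm of
  \<open>Y t\<close> into growth in \<open>coord_sum t\<close>, which the exponential weight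
  controls.\<close>

lemma norm_le_coord_sum: "t \<in> orthant \<Longrightarrow> norm t \<le> coord_sum t"
  using norm_le_l1_cart[of t] by (simp add: orthant_def coord_sum_eq)

lemma component_sum_Basis:
  fixes s :: "'a::euclidean_space \<Rightarrow> real"
  assumes "finite J" "J \<subseteq> Basis" "b \<in> Basis"
  shows "(\<Sum>b\<in>J. s b *\<^sub>R b) \<bullet> b = (if b \<in> J then s b else 0)"
proof -
  have "(\<Sum>b\<in>J. s b *\<^sub>R b) \<bullet> b = (\<Sum>b'\<in>J. if b' = b then s b' else 0)"
    unfolding inner_sum_left using assms by (intro sum.cong) (auto simp: inner_Basis)
  also have "\<dots> = (if b \<in> J then s b else 0)"
    using assms by simp
  finally show ?thesis .
qed

interpretation lborel_product: product_sigma_finite "\<lambda>_. lborel" ..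

lemma integrable_PiM_exp:
  fixes J :: "'i set" and c :: real
  assumes "c > 0" "finite J"
  shows "integrable (Pi\<^sub>M J (\<lambda>_. lborel)) (\<lambda>s :: 'i \<Rightarrow> real. (\<Prod>b\<in>J. indicator {0..} (s b) * exp (- (c * s b))))"
  by (rule lborel_product.product_integrable_prod[where f = "\<lambda>_ x. indicator {0..} x * exp (- (c * x))"])
    (intro assms integrable_exp_half_line)+

text \<open>In the coordinates provided by \<open>lborel_eq\<close>, the indicator and the
  exponential both factor over \<open>Basis\<close>.\<close>

lemma integrable_exp_orthant:
  assumes "c > 0"
  shows "integrable lborel (\<lambda>t :: real ^ 'n::finite. indicator orthant t * exp (- (c * coord_sum t)))"
proof -
  have *: "indicator orthant (\<Sum>b\<in>Basis. s b *\<^sub>R b) * exp (- (c * coord_sum (\<Sum>b\<in>Basis. s b *\<^sub>R b))) =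
      (\<Prod>b\<in>Basis. indicator {0..} (s b) * exp (- (c * s b)))" for s :: "real ^ 'n \<Rightarrow> real"
  proof -
    have 1: "(\<Sum>b\<in>Basis. s b *\<^sub>R b) \<bullet> b = s b" if "b \<in> Basis" for b
      using that component_sum_Basis[of Basis b s] by simp
    have "indicator orthant (\<Sum>b\<in>Basis. s b *\<^sub>R b) = (\<Prod>b\<in>Basis. indicator {0..} (s b) :: real)"
      by (auto simp: indicator_def orthant_iff 1 intro!: prod_zero)
    moreover have "coord_sum (\<Sum>b\<in>Basis. s b *\<^sub>R b) = (\<Sum>b\<in>Basis. s b)"
      by (simp add: coord_sum_def 1)
    ultimately show ?thesis
      by (simp add: prod.distrib exp_sum[symmetric] sum_distrib_left sum_negf)
  qed
  have "integrable (distr (\<Pi>\<^sub>M b\<in>Basis. lborel) borel (\<lambda>f. \<Sum>b\<in>Basis. f b *\<^sub>R b))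
     (\<lambda>t :: real ^ 'n. indicator orthant t * exp (- (c * coord_sum t)))"
    by (subst integrable_distr_eq) (simp_all add: * integrable_PiM_exp assms)
  then show ?thesis by (simp flip: lborel_eq)
qed


section \<open>Recovering a function on the orthant from its mixed derivative\<close>

lemma has_vector_derivative_line:
  fixes F :: "'a::real_vector \<Rightarrow> 'c::real_normed_vector"
  assumes "((\<lambda>h. F ((x + c *\<^sub>R v) + h *\<^sub>R v)) has_vector_derivative D) (at 0)"
  shows "((\<lambda>h. F (x + h *\<^sub>R v)) has_vector_derivative D) (at c)"
proof -
  have "((\<lambda>h. h - c) has_vector_derivative 1) (at c)"
    by (auto intro!: derivative_eq_intros)
  from vector_diff_chain_at[OF this, of "\<lambda>h. F ((x + c *\<^sub>R v) + h *\<^sub>R v)" D] assms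
  have "((\<lambda>h. F (x + c *\<^sub>R v + (h - c) *\<^sub>R v)) has_vector_derivative D) (at c)"
    by (simp add: o_def)
  moreover have "x + c *\<^sub>R v + (h - c) *\<^sub>R v = x + h *\<^sub>R v" for h
    by (simp add: algebra_simps)
  ultimately show ?thesis by simp
qed

text \<open>Downward induction on k: Fubini splits off the coordinate \<open>e k\<close>, and the
  half-line integral in it replaces \<open>H k\<close> by \<open>H (Suc k)\<close>. The induction
  starts at \<open>Suc n\<close>, with no coordinates left to integrate.\<close>

lemma integral_PiM_derivatives:
  fixes H :: "nat \<Rightarrow> real ^ 'n::finite \<Rightarrow> 'c::euclidean_space"
  assumes c: "c > 0"
    and e: "inj_on e {1..n}" "e ` {1..n} \<subseteq> Basis"
    and H: "\<And>k x. k \<in> {1..n} \<Longrightarrow> ((\<lambda>h. H (Suc k) (x + h *\<^sub>R e k)) has_vector_derivative - H k x) (at 0)"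
    and cont: "\<And>k. k \<in> {1..Suc n} \<Longrightarrow> continuous_on UNIV (H k)"
    and bound: "\<And>k x. k \<in> {1..Suc n} \<Longrightarrow> x \<in> orthant \<Longrightarrow> norm (H k x) \<le> C * exp (- (c * coord_sum x))"
    and x: "x \<in> orthant"
    and k: "1 \<le> k" "k \<le> Suc n"
  shows "(LINT s|Pi\<^sub>M (e ` {k..n}) (\<lambda>_. lborel).
      (\<Prod>b\<in>e ` {k..n}. indicator {0..} (s b)) *\<^sub>R H k (x + (\<Sum>b\<in>e ` {k..n}. s b *\<^sub>R b))) = H (Suc n) x"
  using k(2,1)
proof (induction k rule: inc_induct)
  case base
  \<comment> \<open>The product measure over the empty index set is a unit mass at a single
    point.\<close>
  then show ?case by (simp add: PiM_empty lebesgue_integral_count_space_finite)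
next
  case (step k)
  let ?J = "e ` {Suc k..n}"
  let ?G = "\<lambda>J k s. (\<Prod>b\<in>J. indicator {0..} (s b)) *\<^sub>R H k (x + (\<Sum>b\<in>J. s b *\<^sub>R b))"
  have k: "k \<in> {1..n}" using step by auto
  have eq: "e ` {k..n} = insert (e k) ?J"
    using step by (auto simp: image_iff Ball_def) (metis Suc_leI le_eq_less_or_eq atLeastAtMost_iff imageI)+
  have notin: "e k \<notin> ?J"
    using inj_onD[OF e(1), of k] k by fastforce
  have J: "finite ?J" "?J \<subseteq> Basis" "e k \<in> Basis" "finite (e ` {k..n})" "e ` {k..n} \<subseteq> Basis"
    using e(2) k by auto
  have in_orthant: "x + (\<Sum>b\<in>J. s b *\<^sub>R b) \<in> orthant"
    if "finite J" "J \<subseteq> Basis" "\<And>b. b \<in> J \<Longrightarrow> s b \<ge> 0" for J and s :: "real ^ 'n \<Rightarrow> real"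
    using that x by (auto simp: orthant_iff component_sum_Basis inner_add_left)
  have Hk [measurable]: "H k \<in> borel_measurable borel"
    using cont[of k] k by (intro borel_measurable_continuous_onI) auto
  have "integrable (Pi\<^sub>M (e ` {k..n}) (\<lambda>_. lborel)) (?G (e ` {k..n}) k)"
  proof (rule Bochner_Integration.integrable_bound)
    show "integrable (Pi\<^sub>M (e ` {k..n}) (\<lambda>_. lborel))
        (\<lambda>s. C * (\<Prod>b\<in>e ` {k..n}. indicator {0..} (s b) * exp (- (c * s b))))"
      by (intro integrable_mult_right integrable_PiM_exp c) auto
    show "?G (e ` {k..n}) k \<in> borel_measurable (Pi\<^sub>M (e ` {k..n}) (\<lambda>_. lborel))"
      by measurable
    have "norm (?G (e ` {k..n}) k s) \<le>
        norm (C * (\<Prod>b\<in>e ` {k..n}. indicator {0..} (s b) * exp (- (c * s b))))" for s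
    proof (cases "\<forall>b\<in>e ` {k..n}. s b \<ge> 0")
      case True
      let ?y = "\<Sum>b\<in>e ` {k..n}. s b *\<^sub>R b"
      have "coord_sum ?y = (\<Sum>b\<in>e ` {k..n}. s b * coord_sum b)"
        by (simp add: coord_sum_sum coord_sum_scaleR)
      also have "\<dots> = (\<Sum>b\<in>e ` {k..n}. s b)"
        using J by (intro sum.cong) (auto simp: coord_sum_Basis)
      finally have sum: "coord_sum (x + ?y) = coord_sum x + (\<Sum>b\<in>e ` {k..n}. s b)"
        by (simp add: coord_sum_add)
      have "norm (H k (x + ?y)) \<le> C * exp (- (c * coord_sum (x + ?y)))"
        using k J True by (intro bound in_orthant) auto
      also have "C * exp (- (c * coord_sum (x + ?y))) \<le> \<bar>C\<bar> * exp (- (c * (\<Sum>b\<in>e ` {k..n}. s b)))"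
        using coord_sum_nonneg[OF x] c unfolding sum by (intro mult_mono) (auto simp: distrib_left)
      also have "exp (- (c * (\<Sum>b\<in>e ` {k..n}. s b))) = (\<Prod>b\<in>e ` {k..n}. exp (- (c * s b)))"
        using J by (simp add: exp_sum[symmetric] sum_distrib_left sum_negf)
      also have "\<dots> = (\<Prod>b\<in>e ` {k..n}. indicator {0..} (s b) * exp (- (c * s b)))"
        using True by (intro prod.cong) auto
      also have "\<bar>C\<bar> * \<dots> = norm (C * \<dots>)"
        by (simp add: abs_mult abs_prod)
      finally have "norm (H k (x + ?y)) \<le> \<dots>" .
      moreover have "(\<Prod>b\<in>e ` {k..n}. indicator {0..} (s b)) = (1 :: real)"
        using True by (intro prod.neutral) auto
      then have "norm (?G (e ` {k..n}) k s) = norm (H k (x + ?y))"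
        by simp
      ultimately show ?thesis by (simp only:)
    next
      case False
      then have "(\<Prod>b\<in>e ` {k..n}. indicator {0..} (s b)) = (0 :: real)"
        by (intro prod_zero) (auto simp: indicator_def)
      then have "?G (e ` {k..n}) k s = 0" by (simp only: scaleR_zero_left)
      then show ?thesis by (simp only: norm_zero norm_ge_zero)
    qed
    then show "AE s in Pi\<^sub>M (e ` {k..n}) (\<lambda>_. lborel). norm (?G (e ` {k..n}) k s) \<le>
        norm (C * (\<Prod>b\<in>e ` {k..n}. indicator {0..} (s b) * exp (- (c * s b))))"
      by simp
  qed
  then have "(LINT s|Pi\<^sub>M (e ` {k..n}) (\<lambda>_. lborel). ?G (e ` {k..n}) k s) =
      (LINT s|Pi\<^sub>M ?J (\<lambda>_. lborel). LINT y|lborel. ?G (e ` {k..n}) k (s(e k := y)))"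
    unfolding eq by (rule lborel_product.product_integral_insert[OF J(1) notin])
  also have "\<dots> = (LINT s|Pi\<^sub>M ?J (\<lambda>_. lborel). ?G ?J (Suc k) s)"
  proof (rule Bochner_Integration.integral_cong)
    fix s :: "real ^ 'n \<Rightarrow> real"
    let ?p = "(\<Prod>b\<in>?J. indicator {0..} (s b)) :: real" and ?y = "x + (\<Sum>b\<in>?J. s b *\<^sub>R b)"
    have "?G (e ` {k..n}) k (s(e k := y)) = ?p *\<^sub>R (indicator {0..} y *\<^sub>R H k (?y + y *\<^sub>R e k))" for y
    proof -
      have "(\<Prod>b\<in>?J. indicator {0..} ((s(e k := y)) b)) = ?p"
        by (rule prod.cong[OF refl]) (metis fun_upd_other notin)
      moreover have "(\<Sum>b\<in>?J. (s(e k := y)) b *\<^sub>R b) = (\<Sum>b\<in>?J. s b *\<^sub>R b)"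
        by (rule sum.cong[OF refl]) (metis fun_upd_other notin)
      ultimately show ?thesis
        unfolding eq using notin by (simp add: add_ac)
    qed
    then have "(LINT y|lborel. ?G (e ` {k..n}) k (s(e k := y))) =
        ?p *\<^sub>R (LINT y|lborel. indicator {0..} y *\<^sub>R H k (?y + y *\<^sub>R e k))"
      by (simp only: integral_scaleR_right)
    also have "\<dots> = ?p *\<^sub>R H (Suc k) ?y"
    \<comment> \<open>If a remaining coordinate is negative, both sides vanish. Otherwise the base
      point lies in the orthant, where the bounds on H are available.\<close>
    proof (cases "?p = 0")
      case False
      then have "\<forall>b\<in>?J. s b \<ge> 0"
        by (auto simp: indicator_def split: if_splits)
      then have y: "?y \<in> orthant"
        using J by (intro in_orthant) auto
      have "(LINT y|lborel. indicator {0..} y *\<^sub>R H k (?y + y *\<^sub>R e k)) = H (Suc k) (?y + 0 *\<^sub>R e k)"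
      proof (rule integral_half_line_derivative[OF c])
        show "((\<lambda>y. H (Suc k) (?y + y *\<^sub>R e k)) has_vector_derivative - H k (?y + h *\<^sub>R e k)) (at h)" for h
          by (rule has_vector_derivative_line) (rule H[OF k])
        show "continuous_on UNIV (\<lambda>y. H k (?y + y *\<^sub>R e k))"
          using cont[of k] k by (auto intro!: continuous_intros continuous_on_compose2[of UNIV "H k"])
        have *: "norm (H i (?y + h *\<^sub>R e k)) \<le> \<bar>C\<bar> * exp (- (c * h))"
          if "h \<ge> 0" "i \<in> {1..Suc n}" for h i
        proof -
          have "norm (H i (?y + h *\<^sub>R e k)) \<le> C * exp (- (c * coord_sum (?y + h *\<^sub>R e k)))"
            using that J(3) by (intro bound orthant_add[OF y] orthant_scaleR_Basis)
          also have "\<dots> \<le> \<bar>C\<bar> * exp (- (c * h))"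
          proof (intro mult_mono)
            have "coord_sum (?y + h *\<^sub>R e k) = coord_sum ?y + h"
              using J(3) by (simp only: coord_sum_add[of ?y] coord_sum_scaleR coord_sum_Basis mult_1_right)
            then show "exp (- (c * coord_sum (?y + h *\<^sub>R e k))) \<le> exp (- (c * h))"
              using coord_sum_nonneg[OF y] c by simp
          qed auto
          finally show ?thesis .
        qed
        show "norm (H (Suc k) (?y + h *\<^sub>R e k)) \<le> \<bar>C\<bar> * exp (- (c * h))" if "h \<ge> 0" for h
          using * that k by auto
        show "norm (H k (?y + h *\<^sub>R e k)) \<le> \<bar>C\<bar> * exp (- (c * h))" if "h \<ge> 0" for h
          using * that k by auto
      qed
      then show ?thesis by simp
    qed simp
    finally show "(LINT y|lborel. ?G (e ` {k..n}) k (s(e k := y))) = ?G ?J (Suc k) s" .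
  qed simp
  also have "\<dots> = H (Suc n) x"
    using step by simp
  finally show ?case .
qed


text \<open>The case k = 1, in which all coordinates are integrated; translation by x turns the
  region above x into the orthant.\<close>

lemma integral_orthant_derivatives:
  fixes H :: "nat \<Rightarrow> real ^ 'n::finite \<Rightarrow> 'c::euclidean_space"
  assumes c: "c > 0"
    and e: "bij_betw e {1..n} Basis"
    and H: "\<And>k x. k \<in> {1..n} \<Longrightarrow> ((\<lambda>h. H (Suc k) (x + h *\<^sub>R e k)) has_vector_derivative - H k x) (at 0)"
    and cont: "\<And>k. k \<in> {1..Suc n} \<Longrightarrow> continuous_on UNIV (H k)"
    and bound: "\<And>k x. k \<in> {1..Suc n} \<Longrightarrow> x \<in> orthant \<Longrightarrow> norm (H k x) \<le> C * exp (- (c * coord_sum x))"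
    and x: "x \<in> orthant"
  shows "(LINT y|lborel. indicator orthant (y - x) *\<^sub>R H 1 y) = H (Suc n) x"
proof -
  have [measurable]: "H (Suc 0) \<in> borel_measurable borel"
    using cont[of 1] by (intro borel_measurable_continuous_onI) auto
  let ?\<Sigma> = "\<lambda>s :: real ^ 'n \<Rightarrow> real. \<Sum>b\<in>Basis. s b *\<^sub>R b"
  have ind: "indicator orthant (?\<Sigma> s) = (\<Prod>b\<in>Basis. indicator {0..} (s b) :: real)" for s
    by (auto simp: indicator_def orthant_iff component_sum_Basis intro!: prod_zero)
  have "(LINT y|lborel. indicator orthant (y - x) *\<^sub>R H 1 y) =
      (LINT y|distr lborel borel ((+) x). indicator orthant (y - x) *\<^sub>R H 1 y)"
    by (simp add: lborel_distr_plus)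
  also have "\<dots> = (LINT y|lborel. indicator orthant y *\<^sub>R H 1 (x + y))"
    by (subst integral_distr) auto
  also have "\<dots> = (LINT y|distr (\<Pi>\<^sub>M b\<in>Basis. lborel) borel ?\<Sigma>. indicator orthant y *\<^sub>R H 1 (x + y))"
    by (subst lborel_eq) (rule refl)
  also have "\<dots> = (LINT s|(\<Pi>\<^sub>M b\<in>Basis. lborel). indicator orthant (?\<Sigma> s) *\<^sub>R H 1 (x + ?\<Sigma> s))"
    by (subst integral_distr) auto
  also have "\<dots> = H (Suc n) x"
    unfolding ind using integral_PiM_derivatives[where k = 1, OF c bij_betw_imp_inj_on[OF e] _ H cont bound x]
      bij_betw_imp_surj_on[OF e] by simp
  finally show ?thesis .
qed

section \<open>Cayley-Dickson multiplication under the integral sign\<close>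

lemma bilinear_cayley_mult: "bounded_bilinear ((*) :: 'r cayley \<Rightarrow> 'r cayley \<Rightarrow> 'r cayley)"
  unfolding bilinear_conv_bounded_bilinear[symmetric] bilinear_def
  by (auto intro!: linearI simp: cayley_distrib)

lemmas cayley_mult_right = bounded_bilinear.bounded_linear_right[OF bilinear_cayley_mult]
lemmas cayley_mult_left = bounded_bilinear.bounded_linear_left[OF bilinear_cayley_mult]

lemma cayley_mult_zero: "0 * x = 0" "x * 0 = 0" for x :: "'r cayley"
  using cayley_distrib(3)[of 0 0 x] cayley_distrib(4)[of x 0 0] by simp_all

lemma cayley_mult_measurable [measurable (raw)]:
  fixes f g :: "'a \<Rightarrow> 'r cayley"
  assumes "f \<in> borel_measurable M" "g \<in> borel_measurable M"
  shows "(\<lambda>x. f x * g x) \<in> borel_measurable M"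
proof (rule borel_measurable_continuous_on[of "\<lambda>(x, y). x * y", where g = "\<lambda>x. (f x, g x)", simplified])
  show "continuous_on UNIV (\<lambda>(x :: 'r cayley, y). x * y)"
    unfolding case_prod_beta
    by (intro bounded_bilinear.continuous_on[OF bilinear_cayley_mult] continuous_intros)
qed (use assms in measurable)

text \<open>For t below y, monotonicity gives b s(t) \<le> (b + \<delta>) s(y) - \<delta> s(t),
  where s is \<open>coord_sum\<close>. A slightly larger rate in y thus buys an integrable weight in
  t, and the volume of the box never has to be computed.\<close>

lemma order_translate_bound:
  fixes \<phi> :: "real ^ 'n::finite \<Rightarrow> 'c::real_normed_vector"
  assumes \<phi>_bound: "\<And>t. norm (\<phi> t) \<le> C * (indicator orthant t * exp (b * coord_sum t))"
    and "0 \<le> b" "0 \<le> \<delta>"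
  shows "norm (indicator orthant (y - t) *\<^sub>R \<phi> t) \<le>
    (C * exp ((b + \<delta>) * coord_sum y)) * (indicator orthant t * exp (- (\<delta> * coord_sum t)))"
proof (cases "t \<in> orthant \<and> y - t \<in> orthant")
  case True
  then have le: "coord_sum t \<le> coord_sum y"
    using coord_sum_nonneg[of "y - t"] by (simp add: coord_sum_diff)
  have C: "0 \<le> C"
    using order_trans[OF norm_ge_zero \<phi>_bound[of 0]] by (simp add: orthant_def coord_sum_def)
  have "norm (\<phi> t) \<le> C * exp (b * coord_sum t)"
    using \<phi>_bound[of t] True by simp
  also have "\<dots> \<le> C * exp ((b + \<delta>) * coord_sum y + - (\<delta> * coord_sum t))"
  proof (intro mult_left_mono C)
    show "exp (b * coord_sum t) \<le> exp ((b + \<delta>) * coord_sum y + - (\<delta> * coord_sum t))"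
      using mult_left_mono[OF le, of "b + \<delta>"] assms(2,3) by (simp add: algebra_simps)
  qed
  finally show ?thesis using True unfolding exp_add by (simp add: mult.assoc)
next
  case False
  have C: "0 \<le> C"
    using order_trans[OF norm_ge_zero \<phi>_bound[of 0]] by (simp add: orthant_def coord_sum_def)
  have "indicator orthant (y - t) *\<^sub>R \<phi> t = 0"
    using False \<phi>_bound[of t] by (auto simp: indicator_def)
  then have "norm (indicator orthant (y - t) *\<^sub>R \<phi> t) = 0"
    by (simp only: norm_zero)
  then show ?thesis using C by (simp only:) simp
qed

text \<open>Both sides are the integral of \<open>\<phi> t * H y\<close> over \<open>t \<le> y\<close>, the order being componentwise.\<close>

lemma Fubini_orthant:
  fixes \<phi> :: "real ^ 'n::finite \<Rightarrow> 'r cayley" and H :: "real ^ 'n \<Rightarrow> 'r cayley"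
  assumes \<phi> [measurable]: "\<phi> \<in> borel_measurable borel"
    and H [measurable]: "H \<in> borel_measurable borel"
    and \<phi>_bound: "\<And>t. norm (\<phi> t) \<le> C * (indicator orthant t * exp (b * coord_sum t))"
    and H_bound: "\<And>y. y \<in> orthant \<Longrightarrow> norm (H y) \<le> D * exp (- (c * coord_sum y))"
    and bc: "0 \<le> b" "b < c" and D: "D \<ge> 0"
  shows "(LINT t|lborel. \<phi> t * (LINT y|lborel. indicator orthant (y - t) *\<^sub>R H y)) =
    (LINT y|lborel. (LINT t|lborel. indicator orthant (y - t) *\<^sub>R \<phi> t) * H y)"
proof -
  \<comment> \<open>Half of the gap, so that b + \<delta> = c - \<delta>. For t below y this yields
    b s(t) - c s(y) \<le> - \<delta> s(t) - \<delta> s(y) with s = \<open>coord_sum\<close>: a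
    product of two integrable weights dominates the double integrand.\<close>
  define \<delta> where "\<delta> = (c - b) / 2"
  have \<delta>: "\<delta> > 0" "b + \<delta> = c - \<delta>" "b + \<delta> \<ge> 0" using bc by (auto simp: \<delta>_def field_simps)
  obtain K where K: "K > 0" "\<And>x y :: 'r cayley. norm (x * y) \<le> norm x * norm y * K"
    using bounded_bilinear.pos_bounded[OF bilinear_cayley_mult] by blast
  let ?w = "\<lambda>t :: real ^ 'n. indicator orthant t * exp (- (\<delta> * coord_sum t))"
  let ?f = "\<lambda>(t, y). indicator orthant (y - t) *\<^sub>R (\<phi> t * H y)"
  have w: "integrable lborel ?w" by (rule integrable_exp_orthant[OF \<delta>(1)])
  have "integrable (lborel \<Otimes>\<^sub>M lborel) (\<lambda>(t, y). ?w t * ?w y)"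
  proof (rule lborel_pair.Fubini_integrable)
    show "integrable lborel (\<lambda>x. LINT y|lborel. norm (case (x, y) of (t, y) \<Rightarrow> ?w t * ?w y))"
      using w by (simp add: abs_mult)
    show "AE x in lborel. integrable lborel (\<lambda>y. case (x, y) of (t, y) \<Rightarrow> ?w t * ?w y)"
      using w by simp
  qed measurable
  then have "integrable (lborel \<Otimes>\<^sub>M lborel) (\<lambda>z. (C * D * K) * (case z of (t, y) \<Rightarrow> ?w t * ?w y))"
    by (rule integrable_mult_right)
  then have int: "integrable (lborel \<Otimes>\<^sub>M lborel) ?f"
  proof (rule Bochner_Integration.integrable_bound)
    have "norm (?f (t, y)) \<le> norm ((C * D * K) * (?w t * ?w y))" for t y
    proof (cases "t \<in> orthant \<and> y - t \<in> orthant")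
      case True
      then have y: "y \<in> orthant" using orthant_add[of t "y - t"] by simp
      have le: "coord_sum t \<le> coord_sum y"
        using coord_sum_nonneg[of "y - t"] True by (simp add: coord_sum_diff)
      have "norm (\<phi> t * H y) \<le> norm (\<phi> t) * norm (H y) * K"
        by (rule K(2))
      also have "\<dots> \<le> (C * exp (b * coord_sum t)) * (D * exp (- (c * coord_sum y))) * K"
        using \<phi>_bound[of t] H_bound[OF y] True K(1) order_trans[OF norm_ge_zero \<phi>_bound[of t]]
        by (intro mult_right_mono mult_mono) auto
      also have "\<dots> = (C * D * K) * exp (b * coord_sum t - c * coord_sum y)"
        by (simp add: exp_diff exp_minus divide_inverse)
      also have "\<dots> \<le> \<bar>C * D * K\<bar> * exp (b * coord_sum t - c * coord_sum y)"
        by (intro mult_right_mono) auto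
      also have "\<dots> \<le> \<bar>C * D * K\<bar> * exp (- (\<delta> * coord_sum t) + - (\<delta> * coord_sum y))"
      proof (intro mult_left_mono)
        have "(b + \<delta>) * coord_sum t \<le> (c - \<delta>) * coord_sum y"
          unfolding \<delta>(2)[symmetric] using le \<delta>(3) by (rule mult_left_mono)
        then show "exp (b * coord_sum t - c * coord_sum y) \<le> exp (- (\<delta> * coord_sum t) + - (\<delta> * coord_sum y))"
          by (simp add: algebra_simps)
      qed auto
      also have "\<dots> = norm ((C * D * K) * (?w t * ?w y))"
        using True y unfolding exp_add by (simp add: abs_mult)
      finally show ?thesis using True by simp
    next
      case False
      then have "?f (t, y) = 0"
        using \<phi>_bound[of t] by (auto simp: indicator_def cayley_mult_zero)
      then show ?thesis by (simp only: norm_zero norm_ge_zero)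
    qed
    then show "AE z in lborel \<Otimes>\<^sub>M lborel. norm (?f z) \<le> norm ((C * D * K) * (case z of (t, y) \<Rightarrow> ?w t * ?w y))"
      by (intro AE_I2) auto
  qed measurable
  have "(LINT t|lborel. \<phi> t * (LINT y|lborel. indicator orthant (y - t) *\<^sub>R H y)) =
      (LINT t|lborel. LINT y|lborel. ?f (t, y))"
  proof (rule Bochner_Integration.integral_cong)
    fix t
    have "integrable lborel (\<lambda>y. indicator orthant (y - t) *\<^sub>R H y)" if t: "t \<in> orthant"
    proof (rule Bochner_Integration.integrable_bound)
      show "integrable lborel (\<lambda>y. D * (indicator orthant y * exp (- (c * coord_sum y))))"
        using bc by (intro integrable_mult_right integrable_exp_orthant) auto
      show "AE y in lborel. norm (indicator orthant (y - t) *\<^sub>R H y) \<le>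
          norm (D * (indicator orthant y * exp (- (c * coord_sum y))))"
        using orthant_add[OF t] H_bound D by (intro AE_I2) (auto simp: indicator_def abs_mult, force)
    qed measurable
    then have "\<phi> t * (LINT y|lborel. indicator orthant (y - t) *\<^sub>R H y) =
        (LINT y|lborel. \<phi> t * (indicator orthant (y - t) *\<^sub>R H y))" if "t \<in> orthant"
      using that by (intro integral_bounded_linear[OF cayley_mult_right, symmetric])
    moreover have "\<phi> t = 0" if "t \<notin> orthant"
      using \<phi>_bound[of t] that by simp
    ultimately show "\<phi> t * (LINT y|lborel. indicator orthant (y - t) *\<^sub>R H y) = (LINT y|lborel. ?f (t, y))"
      by (cases "t \<in> orthant") (auto simp: cayley_distrib cayley_mult_zero)
  qed simp
  also have "\<dots> = (LINT y|lborel. LINT t|lborel. ?f (t, y))"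
    using lborel_pair.Fubini_integral[of "\<lambda>t y. ?f (t, y)"] int by simp
  also have "\<dots> = (LINT y|lborel. (LINT t|lborel. indicator orthant (y - t) *\<^sub>R \<phi> t) * H y)"
  proof (rule Bochner_Integration.integral_cong)
    fix y
    have "integrable lborel (\<lambda>t. indicator orthant (y - t) *\<^sub>R \<phi> t)"
    proof (rule Bochner_Integration.integrable_bound)
      show "integrable lborel (\<lambda>t. (C * exp ((b + \<delta>) * coord_sum y)) * ?w t)"
        by (intro integrable_mult_right w)
      have "norm (indicator orthant (y - t) *\<^sub>R \<phi> t) \<le> norm ((C * exp ((b + \<delta>) * coord_sum y)) * ?w t)" for t
        using order_trans[OF order_translate_bound[OF \<phi>_bound bc(1) less_imp_le[OF \<delta>(1)], of y t] abs_ge_self]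
        by (simp only: real_norm_def)
      then show "AE t in lborel. norm (indicator orthant (y - t) *\<^sub>R \<phi> t) \<le> norm ((C * exp ((b + \<delta>) * coord_sum y)) * ?w t)"
        by simp
    qed measurable
    from integral_bounded_linear[OF cayley_mult_left this, of "H y"]
    show "(LINT t|lborel. ?f (t, y)) = (LINT t|lborel. indicator orthant (y - t) *\<^sub>R \<phi> t) * H y"
      by (simp add: cayley_distrib)
  qed simp
  finally show ?thesis .
qed

section \<open>Differentiation under the integral sign\<close>

text \<open>The common form of both exponentials without the factor exp (- \<zeta>_0). A derivative
  in \<zeta> acts on \<psi> alone, a derivative in t also on the exponential.\<close>

definition damped ::
  "real \<Rightarrow> (real ^ 'n::finite \<Rightarrow> 'c::euclidean_space) \<Rightarrow> ('c \<Rightarrow> 'c) \<Rightarrow> 'c \<Rightarrow> real ^ 'n \<Rightarrow> 'c" where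
  "damped a Y \<psi> \<zeta> t = exp (- (a * coord_sum t)) *\<^sub>R \<psi> (Y t + \<zeta>)"

lemma damped_continuous:
  assumes "bounded_linear Y" "continuous_on UNIV \<psi>"
  shows "continuous_on UNIV (damped a Y \<psi> \<zeta>)"
  unfolding damped_def[abs_def]
  by (intro continuous_intros linear_continuous_on[OF assms(1)] continuous_on_compose2[OF assms(2)]
    linear_continuous_on[OF bounded_linear_coord_sum]) auto

text \<open>The growth of \<psi> costs an arbitrarily small part \<delta> of the decay rate.
  Uniformity for \<zeta> in a ball is what dominated convergence needs when \<zeta> is
  moved.\<close>

lemma damped_bound:
  fixes Y :: "real ^ 'n::finite \<Rightarrow> 'c::euclidean_space"
  assumes Y: "bounded_linear Y" and \<psi>: "subexponential \<psi>" and \<delta>: "\<delta> > 0"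
  shows "\<exists>D\<ge>0. \<forall>t\<in>orthant. \<forall>\<zeta>. norm \<zeta> \<le> R \<longrightarrow>
    norm (damped a Y \<psi> \<zeta> t) \<le> D * exp (- ((a - \<delta>) * coord_sum t))"
proof -
  obtain B where B: "B > 0" "\<And>t. norm (Y t) \<le> norm t * B"
    using bounded_linear.pos_bounded[OF Y] by blast
  \<comment> \<open>Since the norm of \<open>Y t\<close> is at most \<open>B * coord_sum t\<close>
    on the orthant, rate \<epsilon> for \<psi> becomes rate \<delta> in
    \<open>coord_sum t\<close>.\<close>
  define \<epsilon> where "\<epsilon> = \<delta> / B"
  have \<epsilon>: "\<epsilon> > 0" "\<epsilon> * B = \<delta>" using B(1) \<delta> by (auto simp: \<epsilon>_def)
  obtain C where C: "\<And>y. norm (\<psi> y) \<le> C * exp (\<epsilon> * norm y)"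
    using \<psi> \<epsilon>(1) unfolding subexponential_def by blast
  have C0: "C \<ge> 0" using order_trans[OF norm_ge_zero C[of 0]] by simp
  show ?thesis
  proof (intro exI[of _ "C * exp (\<epsilon> * R)"] conjI ballI allI impI)
    fix t :: "real ^ 'n" and \<zeta> :: 'c assume t: "t \<in> orthant" and \<zeta>: "norm \<zeta> \<le> R"
    have "norm (Y t + \<zeta>) \<le> norm (Y t) + norm \<zeta>"
      by (rule norm_triangle_ineq)
    also have "\<dots> \<le> coord_sum t * B + R"
      using order_trans[OF B(2)[of t] mult_right_mono[OF norm_le_coord_sum[OF t] less_imp_le[OF B(1)]]] \<zeta>
      by (rule add_mono)
    finally have "\<epsilon> * norm (Y t + \<zeta>) \<le> \<epsilon> * (coord_sum t * B + R)"
      using \<epsilon>(1) by (intro mult_left_mono) auto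
    also have "\<dots> = \<delta> * coord_sum t + \<epsilon> * R"
      using \<epsilon>(2) by (simp add: algebra_simps)
    finally have "exp (\<epsilon> * norm (Y t + \<zeta>)) \<le> exp (\<delta> * coord_sum t + \<epsilon> * R)"
      by simp
    from order_trans[OF C mult_left_mono[OF this C0]]
    have "norm (\<psi> (Y t + \<zeta>)) \<le> C * exp (\<delta> * coord_sum t + \<epsilon> * R)" .
    then have "exp (- (a * coord_sum t)) * norm (\<psi> (Y t + \<zeta>)) \<le>
        exp (- (a * coord_sum t)) * (C * exp (\<delta> * coord_sum t + \<epsilon> * R))"
      by (intro mult_left_mono) auto
    also have "\<dots> = C * exp (- (a * coord_sum t) + (\<delta> * coord_sum t + \<epsilon> * R))"
      unfolding exp_add[of "- (a * coord_sum t)"] by simp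
    also have "- (a * coord_sum t) + (\<delta> * coord_sum t + \<epsilon> * R) = \<epsilon> * R + - ((a - \<delta>) * coord_sum t)"
      by (simp add: algebra_simps)
    also have "C * exp \<dots> = C * exp (\<epsilon> * R) * exp (- ((a - \<delta>) * coord_sum t))"
      unfolding exp_add by simp
    finally show "norm (damped a Y \<psi> \<zeta> t) \<le> C * exp (\<epsilon> * R) * exp (- ((a - \<delta>) * coord_sum t))"
      by (simp add: damped_def)
  qed (use C0 in auto)
qed

lemma damped_has_vector_derivative:
  assumes "\<And>y. (\<psi> has_derivative \<psi>' y) (at y)"
  shows "((\<lambda>h. damped a Y \<psi> (\<zeta> + h *\<^sub>R v) t) has_vector_derivative
    damped a Y (\<lambda>y. \<psi>' y v) (\<zeta> + h *\<^sub>R v) t) (at h)"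
proof -
  have "((\<lambda>h. Y t + (\<zeta> + h *\<^sub>R v)) has_derivative (\<lambda>h. h *\<^sub>R v)) (at h)"
    by (auto intro!: derivative_eq_intros)
  from has_derivative_compose[OF this assms]
  have "((\<lambda>h. \<psi> (Y t + (\<zeta> + h *\<^sub>R v))) has_derivative (\<lambda>k. \<psi>' (Y t + (\<zeta> + h *\<^sub>R v)) (k *\<^sub>R v))) (at h)" .
  moreover have "\<psi>' y (k *\<^sub>R v) = k *\<^sub>R \<psi>' y v" for y k
    using linear_cmul[OF has_derivative_linear[OF assms]] .
  ultimately have "((\<lambda>h. \<psi> (Y t + (\<zeta> + h *\<^sub>R v))) has_vector_derivative \<psi>' (Y t + (\<zeta> + h *\<^sub>R v)) v) (at h)"
    by (simp add: has_vector_derivative_def)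
  then show ?thesis
    unfolding damped_def
    by (rule bounded_linear.has_vector_derivative[OF bounded_linear_scaleR_right])
qed

text \<open>Moving t by \<open>h *\<^sub>R e\<close> multiplies the exponential by exp (- a h) and
  moves \<zeta> by \<open>h *\<^sub>R Y e\<close>. This exchange of a derivative in t for one in
  \<zeta> is the mechanism behind the operators R_k.\<close>

lemma damped_shift_derivative:
  assumes \<psi>: "\<And>y. (\<psi> has_derivative \<psi>' y) (at y)" and Y: "bounded_linear Y" and e: "e \<in> Basis"
  shows "((\<lambda>h. damped a Y \<psi> \<zeta> (t + h *\<^sub>R e)) has_vector_derivative
    - damped a Y (\<lambda>y. a *\<^sub>R \<psi> y - \<psi>' y (Y e)) \<zeta> t) (at 0)"
proof -
  have 1: "((\<lambda>h. exp (- (a * coord_sum (t + h *\<^sub>R e)))) has_real_derivative - (a * exp (- (a * coord_sum t)))) (at 0)"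
    using e by (auto intro!: derivative_eq_intros simp: coord_sum_add coord_sum_scaleR coord_sum_Basis)
  have 2: "((\<lambda>h. damped 0 Y \<psi> (\<zeta> + h *\<^sub>R Y e) t) has_vector_derivative \<psi>' (Y t + \<zeta>) (Y e)) (at 0)"
    using damped_has_vector_derivative[OF \<psi>, of 0 Y \<zeta> "Y e" t 0] by (simp add: damped_def)
  have eq: "damped a Y \<psi> \<zeta> (t + h *\<^sub>R e) =
      exp (- (a * coord_sum (t + h *\<^sub>R e))) *\<^sub>R damped 0 Y \<psi> (\<zeta> + h *\<^sub>R Y e) t" for h
    using Y by (simp add: damped_def linear_simps add_ac)
  show ?thesis
    unfolding eq
    using has_vector_derivative_scaleR[OF 1 2]
    by (simp add: damped_def algebra_simps)
qed

section \<open>Integrals against damped functions\<close>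

definition damped_integral ::
  "(real ^ 'n::finite \<Rightarrow> 'r cayley) \<Rightarrow> real \<Rightarrow> (real ^ 'n \<Rightarrow> 'r cayley) \<Rightarrow>
    ('r cayley \<Rightarrow> 'r cayley) \<Rightarrow> 'r cayley \<Rightarrow> 'r cayley" where
  "damped_integral g a Y \<psi> \<zeta> = (LINT t|lborel. g t * damped a Y \<psi> \<zeta> t)"

text \<open>The difference quotient is the form to which dominated convergence applies.\<close>

lemma has_vector_derivative_at_0_iff:
  fixes F :: "real \<Rightarrow> 'c::real_normed_vector"
  shows "(F has_vector_derivative D) (at 0) \<longleftrightarrow> ((\<lambda>h. (F h - F 0) /\<^sub>R h) \<longlongrightarrow> D) (at 0)"
proof -
  have "norm ((F h - F 0) /\<^sub>R h - D) = norm (F (0 + h) - F 0 - h *\<^sub>R D) / norm h" if "h \<noteq> 0" for h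
  proof -
    have "norm (F h - F 0 - h *\<^sub>R D) = norm (h *\<^sub>R ((F h - F 0) /\<^sub>R h - D))"
      using that by (simp add: scaleR_right_diff_distrib)
    then show ?thesis using that by simp
  qed
  then have *: "((\<lambda>h. norm (F (0 + h) - F 0 - h *\<^sub>R D) / norm h) \<longlongrightarrow> 0) (at 0) \<longleftrightarrow>
      ((\<lambda>h. norm ((F h - F 0) /\<^sub>R h - D)) \<longlongrightarrow> 0) (at 0)"
    by (intro tendsto_cong) (auto simp: eventually_at intro!: exI[of _ 1])
  show ?thesis
    unfolding has_vector_derivative_def has_derivative_at *
    by (simp add: bounded_linear_scaleR_left tendsto_norm_zero_iff LIM_zero_iff)
qed

text \<open>By the mean value inequality the quotient inherits any bound on the derivative along the
  segment; for steps of length at most 1 the segment stays in the ball of radius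
  \<open>norm \<zeta> + norm v\<close>.\<close>

lemma damped_difference_quotient_bound:
  fixes \<psi> :: "'c::euclidean_space \<Rightarrow> 'c"
  assumes \<psi>: "\<And>y. (\<psi> has_derivative \<psi>' y) (at y)"
    and bound: "\<And>\<zeta>'. norm \<zeta>' \<le> norm \<zeta> + norm v \<Longrightarrow> norm (damped a Y (\<lambda>y. \<psi>' y v) \<zeta>' t) \<le> B"
    and h: "\<bar>h\<bar> \<le> 1" "h \<noteq> 0"
  shows "norm ((damped a Y \<psi> (\<zeta> + h *\<^sub>R v) t - damped a Y \<psi> \<zeta> t) /\<^sub>R h) \<le> B"
proof -
  let ?f = "\<lambda>h. damped a Y \<psi> (\<zeta> + h *\<^sub>R v) t"
  have "norm (?f h - ?f 0) \<le> B * norm (h - 0)"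
  proof (rule differentiable_bound[of "{-1..1}" ?f "\<lambda>h k. k *\<^sub>R damped a Y (\<lambda>y. \<psi>' y v) (\<zeta> + h *\<^sub>R v) t"])
    fix x :: real assume x: "x \<in> {-1..1}"
    show "(?f has_derivative (\<lambda>k. k *\<^sub>R damped a Y (\<lambda>y. \<psi>' y v) (\<zeta> + x *\<^sub>R v) t)) (at x within {-1..1})"
      using damped_has_vector_derivative[OF \<psi>] has_derivative_at_withinI
      unfolding has_vector_derivative_def by blast
    have "norm (\<zeta> + x *\<^sub>R v) \<le> norm \<zeta> + \<bar>x\<bar> * norm v"
      by (rule order_trans[OF norm_triangle_ineq]) simp
    also have "\<dots> \<le> norm \<zeta> + norm v"
      using x mult_right_mono[of "\<bar>x\<bar>" 1 "norm v"] by auto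
    finally have "norm (damped a Y (\<lambda>y. \<psi>' y v) (\<zeta> + x *\<^sub>R v) t) \<le> B" by (rule bound)
    then show "onorm (\<lambda>k. k *\<^sub>R damped a Y (\<lambda>y. \<psi>' y v) (\<zeta> + x *\<^sub>R v) t) \<le> B"
      by (intro onorm_le) (simp add: mult.commute[of B] mult_left_mono)
  qed (use h in auto)
  then have "norm (?f h - ?f 0) / \<bar>h\<bar> \<le> B" using h by (simp add: pos_divide_le_eq)
  then show ?thesis by (simp add: divide_inverse mult.commute)
qed

text \<open>Instantiated twice: with the Borel representative of f, and with its primitive, which
  has a slightly larger rate b.\<close>

locale damped_transform =
  fixes g :: "real ^ 'n::finite \<Rightarrow> 'r cayley" and C a b :: real and Y :: "real ^ 'n \<Rightarrow> 'r cayley"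
  assumes g_measurable [measurable]: "g \<in> borel_measurable borel"
    and g_bound: "\<And>t. norm (g t) \<le> C * (indicator orthant t * exp (b * coord_sum t))"
    and b_less: "b < a"
    and Y: "bounded_linear Y"
begin

lemma g_zero: "t \<notin> orthant \<Longrightarrow> g t = 0"
  using g_bound[of t] by simp

lemma C_nonneg: "0 \<le> C"
  using order_trans[OF norm_ge_zero g_bound[of 0]] by (simp add: orthant_def coord_sum_def)

text \<open>The majorant comes in two stages. The difference quotients are not of the form
  \<open>damped\<close>, but they obey the same bound B as the derivative, and w dominates the
  product of \<open>g t\<close> with anything bounded by B.\<close>

lemma dominating:
  assumes "subexponential \<psi>"
  shows "\<exists>w B. integrable lborel w \<and> (\<forall>t. 0 \<le> w t) \<and>
    (\<forall>t\<in>orthant. \<forall>\<zeta>. norm \<zeta> \<le> R \<longrightarrow> norm (damped a Y \<psi> \<zeta> t) \<le> B t) \<and>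
    (\<forall>t\<in>orthant. \<forall>x. norm x \<le> B t \<longrightarrow> norm (g t * x) \<le> w t)"
proof -
  \<comment> \<open>One half of the gap absorbs the growth of \<psi>, the other remains as the decay
    rate of w.\<close>
  define \<delta> where "\<delta> = (a - b) / 2"
  have \<delta>: "\<delta> > 0" "a - \<delta> = b + \<delta>" using b_less by (auto simp: \<delta>_def field_simps)
  obtain D where D: "D \<ge> 0" "\<forall>t\<in>orthant. \<forall>\<zeta>. norm \<zeta> \<le> R \<longrightarrow>
      norm (damped a Y \<psi> \<zeta> t) \<le> D * exp (- ((a - \<delta>) * coord_sum t))"
    using damped_bound[OF Y assms \<delta>(1), of R a] by (elim exE conjE) (rule that)
  obtain K where K: "K > 0" "\<And>x y :: 'r cayley. norm (x * y) \<le> norm x * norm y * K"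
    using bounded_bilinear.pos_bounded[OF bilinear_cayley_mult] by blast
  show ?thesis
  proof (intro exI conjI ballI allI impI)
    show "integrable lborel (\<lambda>t :: real ^ 'n. (C * D * K) * (indicator orthant t * exp (- (\<delta> * coord_sum t))))"
      by (intro integrable_mult_right integrable_exp_orthant \<delta>)
    show "0 \<le> (C * D * K) * (indicator orthant t * exp (- (\<delta> * coord_sum t)))" for t :: "real ^ 'n"
      using D(1) C_nonneg K(1) by simp
    show "norm (damped a Y \<psi> \<zeta> t) \<le> D * exp (- ((a - \<delta>) * coord_sum t))"
      if "t \<in> orthant" "norm \<zeta> \<le> R" for t \<zeta>
      using that D(2) by simp
    fix t :: "real ^ 'n" and x :: "'r cayley" assume t: "t \<in> orthant" and x: "norm x \<le> D * exp (- ((a - \<delta>) * coord_sum t))"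
    have "norm (g t * x) \<le> norm (g t) * norm x * K" by (rule K(2))
    also have "\<dots> \<le> (C * exp (b * coord_sum t)) * (D * exp (- ((a - \<delta>) * coord_sum t))) * K"
      using g_bound[of t] t x K(1) C_nonneg by (intro mult_right_mono mult_mono) auto
    also have "\<dots> = (C * D * K) * (exp (b * coord_sum t) * exp (- ((a - \<delta>) * coord_sum t)))"
      by (simp add: algebra_simps)
    also have "exp (b * coord_sum t) * exp (- ((a - \<delta>) * coord_sum t)) = exp (- (\<delta> * coord_sum t))"
      unfolding \<delta>(2) exp_add[symmetric] by (simp add: algebra_simps)
    finally show "norm (g t * x) \<le> (C * D * K) * (indicator orthant t * exp (- (\<delta> * coord_sum t)))"
      using t by simp
  qed
qed

lemma integrand_measurable:
  assumes "continuous_on UNIV \<psi>"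
  shows "(\<lambda>t. g t * damped a Y \<psi> \<zeta> t) \<in> borel_measurable borel"
  by (intro cayley_mult_measurable g_measurable borel_measurable_continuous_onI damped_continuous Y assms)

lemma damped_integrable:
  assumes "tempered m \<psi>"
  shows "integrable lborel (\<lambda>t. g t * damped a Y \<psi> \<zeta> t)"
proof -
  obtain w B where w: "integrable lborel w" "\<forall>t. 0 \<le> w t"
    "\<forall>t\<in>orthant. \<forall>\<zeta>'. norm \<zeta>' \<le> norm \<zeta> \<longrightarrow> norm (damped a Y \<psi> \<zeta>' t) \<le> B t"
    "\<forall>t\<in>orthant. \<forall>x. norm x \<le> B t \<longrightarrow> norm (g t * x) \<le> w t"
    using dominating[OF tempered_subexponential[OF assms], of "norm \<zeta>"] by (elim exE conjE) (rule that)
  show ?thesis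
  proof (rule Bochner_Integration.integrable_bound[OF w(1)])
    have "norm (g t * damped a Y \<psi> \<zeta> t) \<le> w t" for t
      using w(2,3,4) by (cases "t \<in> orthant") (auto simp: g_zero cayley_mult_zero)
    then show "AE t in lborel. norm (g t * damped a Y \<psi> \<zeta> t) \<le> norm (w t)"
      using w(2) by simp
  qed (use integrand_measurable[OF tempered_continuous[OF assms]] in simp)
qed

lemma damped_integral_derivative:
  assumes \<psi>: "tempered 0 \<psi>" "\<And>y. (\<psi> has_derivative \<psi>' y) (at y)" "tempered 0 (\<lambda>y. \<psi>' y v)"
  shows "((\<lambda>h. damped_integral g a Y \<psi> (\<zeta> + h *\<^sub>R v)) has_vector_derivative
    damped_integral g a Y (\<lambda>y. \<psi>' y v) \<zeta>) (at 0)"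
  unfolding has_vector_derivative_at_0_iff
proof -
  obtain w B where w: "integrable lborel w" "\<forall>t. 0 \<le> w t"
    "\<forall>t\<in>orthant. \<forall>\<zeta>'. norm \<zeta>' \<le> norm \<zeta> + norm v \<longrightarrow> norm (damped a Y (\<lambda>y. \<psi>' y v) \<zeta>' t) \<le> B t"
    "\<forall>t\<in>orthant. \<forall>x. norm x \<le> B t \<longrightarrow> norm (g t * x) \<le> w t"
    using dominating[OF tempered_subexponential[OF \<psi>(3)], of "norm \<zeta> + norm v"] by (elim exE conjE) (rule that)
  let ?q = "\<lambda>h t. (damped a Y \<psi> (\<zeta> + h *\<^sub>R v) t - damped a Y \<psi> \<zeta> t) /\<^sub>R h"
  let ?F = "\<lambda>h. damped_integral g a Y \<psi> (\<zeta> + h *\<^sub>R v)"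
  have F: "(?F h - ?F 0) /\<^sub>R h = (LINT t|lborel. g t * ?q h t)" for h
  proof -
    have "(LINT t|lborel. g t * ?q h t) =
        (LINT t|lborel. (g t * damped a Y \<psi> (\<zeta> + h *\<^sub>R v) t - g t * damped a Y \<psi> (\<zeta> + 0 *\<^sub>R v) t) /\<^sub>R h)"
      by (simp add: cayley_distrib linear_simps[OF cayley_mult_right])
    also have "\<dots> = (?F h - ?F 0) /\<^sub>R h"
      unfolding damped_integral_def
      using damped_integrable[OF \<psi>(1)] by simp
    finally show ?thesis by simp
  qed
  \<comment> \<open>The restriction to steps below 1 makes the mean value bound applicable; the
    interval is open, so the limit at 0 is the same.\<close>
  have "((\<lambda>h. LINT t|lborel. g t * ?q h t) \<longlongrightarrow> damped_integral g a Y (\<lambda>y. \<psi>' y v) \<zeta>) (at 0 within {-1<..<1})"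
    unfolding tendsto_at_iff_sequentially
  proof (intro allI impI)
    fix X :: "nat \<Rightarrow> real" assume X: "\<forall>i. X i \<in> {-1<..<1} - {0}" "X \<longlonglongrightarrow> 0"
    show "((\<lambda>h. LINT t|lborel. g t * ?q h t) \<circ> X) \<longlonglongrightarrow> damped_integral g a Y (\<lambda>y. \<psi>' y v) \<zeta>"
      unfolding o_def damped_integral_def
    proof (rule integral_dominated_convergence)
      show "integrable lborel w" by fact
      show "(\<lambda>t. g t * damped a Y (\<lambda>y. \<psi>' y v) \<zeta> t) \<in> borel_measurable lborel"
        using integrand_measurable[OF tempered_continuous[OF \<psi>(3)]] by simp
      show "(\<lambda>t. g t * ?q (X i) t) \<in> borel_measurable lborel" for i
        unfolding measurable_lborel2
        by (intro cayley_mult_measurable g_measurable borel_measurable_scaleR borel_measurable_const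
          borel_measurable_diff borel_measurable_continuous_onI damped_continuous Y tempered_continuous[OF \<psi>(1)])
      have "(\<lambda>i. g t * ?q (X i) t) \<longlonglongrightarrow> g t * damped a Y (\<lambda>y. \<psi>' y v) \<zeta> t" for t
      proof -
        have "((\<lambda>h. ?q h t) \<longlongrightarrow> damped a Y (\<lambda>y. \<psi>' y v) \<zeta> t) (at 0)"
          using damped_has_vector_derivative[OF \<psi>(2), of a Y \<zeta> v t 0]
          by (simp add: has_vector_derivative_at_0_iff)
        then have "(\<lambda>i. ?q (X i) t) \<longlonglongrightarrow> damped a Y (\<lambda>y. \<psi>' y v) \<zeta> t"
          by (rule filterlim_compose) (use X in \<open>auto simp: filterlim_at\<close>)
        then show ?thesis
          by (rule bounded_linear.tendsto[OF cayley_mult_right])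
      qed
      then show "AE t in lborel. (\<lambda>i. g t * ?q (X i) t) \<longlonglongrightarrow> g t * damped a Y (\<lambda>y. \<psi>' y v) \<zeta> t"
        by simp
      have "norm (g t * ?q (X i) t) \<le> w t" for i t
      proof (cases "t \<in> orthant")
        case True
        have "\<bar>X i\<bar> \<le> 1" "X i \<noteq> 0" using X(1)[rule_format, of i] by auto
        then show ?thesis
          using w(3,4) True by (blast intro: damped_difference_quotient_bound[OF \<psi>(2)])
      qed (use w(2) in \<open>simp add: g_zero cayley_mult_zero\<close>)
      then show "AE t in lborel. norm (g t * ?q (X i) t) \<le> w t" for i
        by simp
    qed
  qed
  moreover have "at (0::real) within {-1<..<1} = at 0"
    by (rule at_within_open) auto
  ultimately show "((\<lambda>h. (?F h - ?F 0) /\<^sub>R h) \<longlongrightarrow> damped_integral g a Y (\<lambda>y. \<psi>' y v) \<zeta>) (at 0)"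
    unfolding F by simp
qed

text \<open>Real scalars pass through the multiplication by \<open>g t\<close>, so a linear
  combination of derivatives of \<psi> becomes the same combination of integrals.\<close>

lemma damped_integral_symbol:
  assumes \<psi>: "tempered 0 \<psi>" "\<And>v. tempered 0 (\<lambda>y. \<psi>' y v)"
    and lin: "\<And>y. linear (\<psi>' y)" and J: "finite J"
  shows "damped_integral g a Y (\<lambda>y. c *\<^sub>R \<psi> y - \<psi>' y (\<Sum>j\<in>J. q j *\<^sub>R d j)) \<zeta> =
    c *\<^sub>R damped_integral g a Y \<psi> \<zeta> - (\<Sum>j\<in>J. q j *\<^sub>R damped_integral g a Y (\<lambda>y. \<psi>' y (d j)) \<zeta>)"
proof -
  have "g t * damped a Y (\<lambda>y. c *\<^sub>R \<psi> y - \<psi>' y (\<Sum>j\<in>J. q j *\<^sub>R d j)) \<zeta> t =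
      c *\<^sub>R (g t * damped a Y \<psi> \<zeta> t) - (\<Sum>j\<in>J. q j *\<^sub>R (g t * damped a Y (\<lambda>y. \<psi>' y (d j)) \<zeta> t))" for t
  proof -
    have "damped a Y (\<lambda>y. c *\<^sub>R \<psi> y - \<psi>' y (\<Sum>j\<in>J. q j *\<^sub>R d j)) \<zeta> t =
        c *\<^sub>R damped a Y \<psi> \<zeta> t - (\<Sum>j\<in>J. q j *\<^sub>R damped a Y (\<lambda>y. \<psi>' y (d j)) \<zeta> t)"
      by (simp add: damped_def linear_sum[OF lin] linear_cmul[OF lin] scaleR_right_diff_distrib
          scaleR_sum_right mult.commute)
    then show ?thesis
      by (simp add: linear_simps[OF cayley_mult_right] linear_sum[OF bounded_linear.linear[OF cayley_mult_right]]
          cayley_distrib)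
  qed
  then show ?thesis
    unfolding damped_integral_def
    using damped_integrable[OF \<psi>(1)] damped_integrable[OF \<psi>(2)] by simp
qed

end

section \<open>Symbols of the operators and repeated integration by parts\<close>

text \<open>The effect of \<open>R\<^sub>k\<close> on \<open>\<psi>\<close>, where \<open>w\<close> is its direction of differentiation.\<close>

definition symbol :: "real \<Rightarrow> 'c::euclidean_space \<Rightarrow> ('c \<Rightarrow> 'c) \<Rightarrow> 'c \<Rightarrow> 'c" where
  "symbol a w \<psi> = (\<lambda>y. a *\<^sub>R \<psi> y - frechet_derivative \<psi> (at y) w)"

text \<open>Replaces the existentially quantified derivative in \<open>tempered\<close> by a
  canonical one, so that \<open>symbol\<close> can be a function of \<psi>.\<close>

lemma tempered_frechet_derivative:
  assumes "tempered (Suc m) \<psi>"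
  shows "(\<psi> has_derivative frechet_derivative \<psi> (at y)) (at y)"
    and "tempered m (\<lambda>y. frechet_derivative \<psi> (at y) v)"
proof -
  obtain \<psi>' where \<psi>': "\<forall>y. (\<psi> has_derivative \<psi>' y) (at y)" "\<forall>v. tempered m (\<lambda>y. \<psi>' y v)"
    using tempered_derivative[OF assms] by blast
  moreover have "frechet_derivative \<psi> (at y) = \<psi>' y" for y
    by (rule frechet_derivative_at[symmetric]) (simp add: \<psi>'(1))
  ultimately show "(\<psi> has_derivative frechet_derivative \<psi> (at y)) (at y)"
    "tempered m (\<lambda>y. frechet_derivative \<psi> (at y) v)"
    by simp_all
qed

lemma tempered_symbol:
  assumes "tempered (Suc m) \<psi>"
  shows "tempered m (symbol a w \<psi>)"
  unfolding symbol_def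
  by (intro tempered_diff tempered_scaleR tempered_const tempered_SucD[OF assms]
    tempered_frechet_derivative(2)[OF assms])

text \<open>The fold runs in the order of \<open>R_comp\<close>, the symbol of index n acting
  first.\<close>

definition iterated_symbol ::
  "real \<Rightarrow> (nat \<Rightarrow> 'c::euclidean_space) \<Rightarrow> nat \<Rightarrow> ('c \<Rightarrow> 'c) \<Rightarrow> nat \<Rightarrow> 'c \<Rightarrow> 'c" where
  "iterated_symbol a w n \<psi> k = foldr (\<lambda>j. symbol a (w j)) [k..<Suc n] \<psi>"

lemma iterated_symbol_last: "iterated_symbol a w n \<psi> (Suc n) = \<psi>"
  by (simp add: iterated_symbol_def)

lemma iterated_symbol_step:
  "k \<le> n \<Longrightarrow> iterated_symbol a w n \<psi> k = symbol a (w k) (iterated_symbol a w n \<psi> (Suc k))"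
  by (simp add: iterated_symbol_def upt_rec[of k])

text \<open>Each symbol uses up one order of differentiability; n - k + 1 of the n orders are spent
  when index k is reached.\<close>

lemma tempered_iterated_symbol:
  assumes "tempered n \<psi>" "k \<le> Suc n" "1 \<le> k"
  shows "tempered (k - 1) (iterated_symbol a w n \<psi> k)"
  using assms(2,3)
proof (induction k rule: inc_induct)
  case base
  then show ?case using assms(1) by (simp add: iterated_symbol_last)
next
  case (step k)
  then have "tempered (Suc (k - 1)) (iterated_symbol a w n \<psi> (Suc k))"
    by simp
  then show ?case
    using step by (simp add: iterated_symbol_step tempered_symbol)
qed

text \<open>The damped function is rewritten as the integral of its n-fold symbol over all y above
  t; exchanging the integrals then moves the integration onto \<phi>.\<close>

lemma damped_integral_by_parts:
  fixes \<phi> :: "real ^ 'n::finite \<Rightarrow> 'r cayley"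
  assumes \<phi>: "\<phi> \<in> borel_measurable borel"
    and \<phi>_bound: "\<And>t. norm (\<phi> t) \<le> C * (indicator orthant t * exp (b * coord_sum t))"
    and ab: "0 \<le> b" "b < a" and Y: "bounded_linear Y" and e: "bij_betw e {1..n} Basis"
    and w: "\<And>k. k \<in> {1..n} \<Longrightarrow> Y (e k) = w k" and \<psi>: "tempered n \<psi>"
  shows "damped_integral \<phi> a Y \<psi> \<zeta> =
    damped_integral (\<lambda>y. LINT t|lborel. indicator orthant (y - t) *\<^sub>R \<phi> t) a Y (iterated_symbol a w n \<psi> 1) \<zeta>"
proof -
  let ?\<Psi> = "iterated_symbol a w n \<psi>"
  let ?H = "\<lambda>k. damped a Y (?\<Psi> k) \<zeta>"
  \<comment> \<open>The rate c below is the midpoint of b and a: the upper half of the gap pays for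
    the growth of the symbols, and b < c remains for Fubini.\<close>
  define \<delta> where "\<delta> = (a - b) / 2"
  define c where "c = a - \<delta>"
  have \<delta>: "\<delta> > 0" "b < c" "c > 0" using ab by (auto simp: \<delta>_def c_def field_simps)
  have temp: "tempered (k - 1) (?\<Psi> k)" if "k \<in> {1..Suc n}" for k
    using that by (intro tempered_iterated_symbol[OF \<psi>]) auto
  have cont: "continuous_on UNIV (?H k)" if "k \<in> {1..Suc n}" for k
    by (intro damped_continuous Y tempered_continuous[OF temp[OF that]])
  have "\<exists>D. D \<ge> 0 \<and> (\<forall>t\<in>orthant. norm (?H k t) \<le> D * exp (- (c * coord_sum t)))" if k: "k \<in> {1..Suc n}" for k
  proof -
    obtain D where "D \<ge> 0" "\<forall>t\<in>orthant. \<forall>\<zeta>'. norm \<zeta>' \<le> norm \<zeta> \<longrightarrow>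
        norm (damped a Y (?\<Psi> k) \<zeta>' t) \<le> D * exp (- ((a - \<delta>) * coord_sum t))"
      using damped_bound[OF Y tempered_subexponential[OF temp[OF k]] \<delta>(1), of "norm \<zeta>" a]
      by (elim exE conjE) (rule that)
    then show ?thesis
      unfolding c_def by (intro exI[of _ D]) simp
  qed
  then have "\<forall>k\<in>{1..Suc n}. \<exists>D. D \<ge> 0 \<and> (\<forall>t\<in>orthant. norm (?H k t) \<le> D * exp (- (c * coord_sum t)))"
    by blast
  then obtain D where D: "\<forall>k\<in>{1..Suc n}. D k \<ge> 0 \<and> (\<forall>t\<in>orthant. norm (?H k t) \<le> D k * exp (- (c * coord_sum t)))"
    by (rule bchoice[THEN exE])
  \<comment> \<open>A single constant has to serve all k; the sum of the finitely many nonnegative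
    ones does.\<close>
  have bound: "norm (?H k t) \<le> (\<Sum>k\<in>{1..Suc n}. D k) * exp (- (c * coord_sum t))"
    if "k \<in> {1..Suc n}" "t \<in> orthant" for k t
  proof -
    have "D k \<le> (\<Sum>k\<in>{1..Suc n}. D k)"
      using that D by (intro member_le_sum) auto
    then have "D k * exp (- (c * coord_sum t)) \<le> (\<Sum>k\<in>{1..Suc n}. D k) * exp (- (c * coord_sum t))"
      by (rule mult_right_mono) simp
    moreover have "norm (?H k t) \<le> D k * exp (- (c * coord_sum t))"
      using D that by simp
    ultimately show ?thesis by (rule order_trans[rotated])
  qed
  have deriv: "((\<lambda>h. ?H (Suc k) (t + h *\<^sub>R e k)) has_vector_derivative - ?H k t) (at 0)" if k: "k \<in> {1..n}" for k t
  proof -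
    have "tempered (Suc (k - 1)) (?\<Psi> (Suc k))" using temp[of "Suc k"] k by simp
    from damped_shift_derivative[OF tempered_frechet_derivative(1)[OF this] Y, of "e k"]
    show ?thesis
      using bij_betwE[OF e] k by (simp add: iterated_symbol_step symbol_def w)
  qed
  have "damped_integral \<phi> a Y \<psi> \<zeta> = (LINT t|lborel. \<phi> t * ?H (Suc n) t)"
    by (simp add: damped_integral_def iterated_symbol_last)
  also have "\<dots> = (LINT t|lborel. \<phi> t * (LINT y|lborel. indicator orthant (y - t) *\<^sub>R ?H 1 y))"
  proof (rule Bochner_Integration.integral_cong[OF refl])
    fix t :: "real ^ 'n"
    show "\<phi> t * ?H (Suc n) t = \<phi> t * (LINT y|lborel. indicator orthant (y - t) *\<^sub>R ?H 1 y)"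
    proof (cases "t \<in> orthant")
      case True
      then show ?thesis
        using integral_orthant_derivatives[OF \<delta>(3) e deriv cont bound True] by simp
    next
      case False
      then have "\<phi> t = 0" using \<phi>_bound[of t] by simp
      then show ?thesis by (simp add: cayley_mult_zero)
    qed
  qed
  also have "\<dots> = (LINT y|lborel. (LINT t|lborel. indicator orthant (y - t) *\<^sub>R \<phi> t) * ?H 1 y)"
    using D by (intro Fubini_orthant[OF \<phi> borel_measurable_continuous_onI[OF cont] \<phi>_bound bound ab(1) \<delta>(2)] sum_nonneg) auto
  finally show ?thesis by (simp add: damped_integral_def)
qed

section \<open>The exponentials of the kernels\<close>

lemma cd_lo_unit: "cd_lo r (\<lambda>i. if i = 0 then 1 else 0) = (\<lambda>i. if i = 0 then 1 else 0)"
  by (auto simp: cd_lo_def)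

lemma cd_hi_unit: "cd_hi r (\<lambda>i. if i = 0 then 1 else 0) = (\<lambda>_. 0)"
  by (auto simp: cd_hi_def)

lemma cd_conj_unit: "cd_conj r (\<lambda>i. if i = 0 then 1 else 0) = (\<lambda>i. if i = 0 then 1 else 0)"
  by (subst cd_conj_coeff) auto

lemma cd_conj_zero: "cd_conj r (\<lambda>_. 0) = (\<lambda>_. 0)"
  using cd_conj_linear[of r 0 "\<lambda>_. 0" 0 "\<lambda>_. 0"] by simp

lemma cd_mult_zero: "cd_mult r (\<lambda>_. 0) y = (\<lambda>_. 0)" "cd_mult r y (\<lambda>_. 0) = (\<lambda>_. 0)"
  using cd_mult_bilinear(1)[of r 0 "\<lambda>_. 0" 0 "\<lambda>_. 0" y] cd_mult_bilinear(2)[of r y 0 "\<lambda>_. 0" 0 "\<lambda>_. 0"]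
  by simp_all

text \<open>Both sides are proved together, because in the upper half of the doubling formula
  multiplication by 1 on the left becomes multiplication on the right.\<close>

lemma cd_mult_unit:
  assumes "\<forall>i\<ge>2 ^ r. x i = 0"
  shows "cd_mult r (\<lambda>i. if i = 0 then 1 else 0) x = x" "cd_mult r x (\<lambda>i. if i = 0 then 1 else 0) = x"
proof -
  have "cd_mult r (\<lambda>i. if i = 0 then 1 else 0) x = x \<and> cd_mult r x (\<lambda>i. if i = 0 then 1 else 0) = x"
    using assms
  proof (induction r arbitrary: x)
    case 0
    then show ?case by (auto simp: fun_eq_iff)
  next
    case (Suc r)
    have "\<forall>i\<ge>2 ^ r. cd_lo r x i = 0" "\<forall>i\<ge>2 ^ r. cd_hi r x i = 0"
      by (auto simp: cd_lo_def cd_hi_def)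
    note IH = Suc.IH[OF this(1)] Suc.IH[OF this(2)]
    have "cd_join r (cd_lo r x) (cd_hi r x) = x"
      using Suc.prems by (auto simp: fun_eq_iff cd_join_def cd_lo_def cd_hi_def)
    then show ?case
      using IH by (simp add: cd_lo_unit cd_hi_unit cd_conj_unit cd_conj_zero cd_mult_zero)
  qed
  then show "cd_mult r (\<lambda>i. if i = 0 then 1 else 0) x = x" "cd_mult r x (\<lambda>i. if i = 0 then 1 else 0) = x"
    by auto
qed

lemma cayley_mult_one: "1 * x = x" "x * 1 = x" for x :: "'r cayley"
  by (transfer, simp add: cd_mult_unit)+

lemma cayley_imaginary_square:
  fixes v :: "'r cayley"
  assumes "cd_coeff v 0 = 0" "norm v = 1"
  shows "v * v = - 1"
proof -
  have "cayley_cnj v = - v"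
    using assms(1) by (intro cayley_eqI) (auto simp: cd_coeff_cnj)
  then have "v * (- v) = 1"
    using cayley_mult_cnj[of v] assms(2) by simp
  moreover have "v * (- v) = - (v * v)"
    by (simp add: linear_simps[OF cayley_mult_right])
  ultimately show ?thesis by (metis minus_minus)
qed

text \<open>The unit imaginary \<open>v\<close> spans with 1 a copy of the complex numbers.\<close>

lemma cayley_exp_complex:
  fixes v :: "'r cayley"
  assumes v: "v * v = - 1"
  shows "cayley_exp (a *\<^sub>R 1 + b *\<^sub>R v) = exp a *\<^sub>R (cos b *\<^sub>R 1 + sin b *\<^sub>R v)"
proof -
  define \<phi> :: "complex \<Rightarrow> 'r cayley" where "\<phi> c = Re c *\<^sub>R 1 + Im c *\<^sub>R v" for c
  have lin: "bounded_linear \<phi>"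
    unfolding \<phi>_def[abs_def]
    by (intro bounded_linear_add bounded_linear_scaleR_const bounded_linear_Re bounded_linear_Im)
  have mult: "\<phi> (c * d) = \<phi> c * \<phi> d" for c d
    by (simp add: \<phi>_def cayley_distrib cayley_mult_one v algebra_simps)
  \<comment> \<open>Powers are bracketed to the right on both sides, so multiplicativity of \<phi>
    suffices and no associativity is involved.\<close>
  have power: "\<phi> (c ^ k) = \<phi> c ^ k" for c k
    by (induction k) (simp_all add: mult, simp add: \<phi>_def)
  have "(\<lambda>k. Complex a b ^ k /\<^sub>R fact k) sums exp (Complex a b)"
    by (rule exp_converges)
  from bounded_linear.sums[OF lin this]
  have "(\<lambda>k. \<phi> (Complex a b) ^ k /\<^sub>R fact k) sums \<phi> (exp (Complex a b))"
    by (simp add: linear_simps[OF lin] power)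
  then have "cayley_exp (\<phi> (Complex a b)) = \<phi> (exp (Complex a b))"
    unfolding cayley_exp_def by (rule sums_unique[symmetric])
  then show ?thesis
    by (simp add: \<phi>_def Re_exp Im_exp scaleR_right_distrib)
qed

lemma norm_cayley_eq: "(norm x)\<^sup>2 = (\<Sum>i<2 ^ CARD('r). (cd_coeff x i)\<^sup>2)" for x :: "'r cayley"
  unfolding power2_norm_eq_inner inner_cayley_def by (simp add: power2_eq_square)

lemma bounded_linear_cd_coeff: "bounded_linear (\<lambda>y :: 'r cayley. cd_coeff y j)"
  by (simp add: linear_conv_bounded_linear[symmetric] linear_iff)

lemma tempered_cd_coeff: "tempered m (\<lambda>y :: 'r cayley. cd_coeff y j)"
  by (rule tempered_linear[OF bounded_linear_cd_coeff])

section \<open>Unit imaginary directions and the exponentials in closed form\<close>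

definition sphere_direction :: "(nat \<Rightarrow> real) \<Rightarrow> 'r cayley" where
  "sphere_direction \<phi> = (let K = 2 ^ CARD('r) - 1 in
    \<Sum>j=1..K. ((\<Prod>m=2..j. sin (\<phi> m)) * (if j < K then cos (\<phi> (j + 1)) else 1)) *\<^sub>R cbasis j)"

lemma cd_coeff_sphere_direction:
  assumes "i < 2 ^ CARD('r)"
  shows "cd_coeff (sphere_direction \<phi> :: 'r cayley) i =
    (if i = 0 then 0 else (\<Prod>m=2..i. sin (\<phi> m)) * (if i < 2 ^ CARD('r) - 1 then cos (\<phi> (i + 1)) else 1))"
proof -
  let ?c = "\<lambda>j. (\<Prod>m=2..j. sin (\<phi> m)) * (if j < 2 ^ CARD('r) - 1 then cos (\<phi> (j + 1)) else 1)"
  have "cd_coeff (sphere_direction \<phi> :: 'r cayley) i = (\<Sum>j=1..2 ^ CARD('r) - 1. if j = i then ?c j else 0)"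
    unfolding sphere_direction_def Let_def cd_coeff_sum
    by (intro sum.cong) (auto simp: cd_coeff_cbasis)
  also have "\<dots> = (if i = 0 then 0 else ?c i)"
    using assms by (auto simp: sum.delta')
  finally show ?thesis .
qed

text \<open>Telescoping: by cos^2 = 1 - sin^2, each term is the difference of two consecutive
  squared products of sines.\<close>

lemma sum_spherical_squares:
  "(\<Sum>j=1..J. ((\<Prod>m=2..j. sin (\<phi> m)) * cos (\<phi> (j + 1)))\<^sup>2) = 1 - (\<Prod>m=2..J+1. sin (\<phi> m))\<^sup>2"
  for \<phi> :: "nat \<Rightarrow> real"
proof (induction J)
  case (Suc J)
  then show ?case
    by (simp add: power_mult_distrib cos_squared_eq algebra_simps)
qed simp

text \<open>These are hyperspherical coordinates; the last coordinate, which carries no cosine,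
  supplies exactly the remainder of the telescoping sum.\<close>

lemma norm_sphere_direction: 
  assumes "CARD('r) > 0"
  shows "norm (sphere_direction \<phi> :: 'r cayley) = 1"
proof -
  \<comment> \<open>This K is one less than that of the kernel, so \<open>Suc K\<close> is the index
    of the last coordinate.\<close>
  obtain K where K: "2 ^ CARD('r) = Suc (Suc K)"
  proof -
    have "(2::nat) ^ 1 \<le> 2 ^ CARD('r)" using assms by (intro power_increasing) auto
    then show ?thesis using that[of "2 ^ CARD('r) - 2"] by simp
  qed
  have "(norm (sphere_direction \<phi> :: 'r cayley))\<^sup>2 =
      (\<Sum>i<Suc (Suc K). (cd_coeff (sphere_direction \<phi> :: 'r cayley) i)\<^sup>2)"
    by (simp add: norm_cayley_eq K)
  also have "\<dots> = (\<Sum>i=1..K. (cd_coeff (sphere_direction \<phi> :: 'r cayley) i)\<^sup>2)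
      + (cd_coeff (sphere_direction \<phi> :: 'r cayley) (Suc K))\<^sup>2"
    by (simp add: lessThan_Suc_atMost atLeast0AtMost[symmetric] sum.atLeast_Suc_atMost[of 0]
        cd_coeff_sphere_direction K)
  also have "(\<Sum>i=1..K. (cd_coeff (sphere_direction \<phi> :: 'r cayley) i)\<^sup>2) =
      (\<Sum>i=1..K. ((\<Prod>m=2..i. sin (\<phi> m)) * cos (\<phi> (i + 1)))\<^sup>2)"
    by (intro sum.cong) (auto simp: cd_coeff_sphere_direction K)
  also have "\<dots> = 1 - (\<Prod>m=2..K+1. sin (\<phi> m))\<^sup>2"
    by (rule sum_spherical_squares)
  also have "(cd_coeff (sphere_direction \<phi> :: 'r cayley) (Suc K))\<^sup>2 = (\<Prod>m=2..K+1. sin (\<phi> m))\<^sup>2"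
    by (simp add: cd_coeff_sphere_direction K)
  finally have "(norm (sphere_direction \<phi> :: 'r cayley))\<^sup>2 = 1" by simp
  then show ?thesis
    by (metis norm_ge_zero power2_eq_1_iff not_one_le_zero le_minus_one_simps(3) order_trans)
qed

definition imag :: "'r cayley \<Rightarrow> 'r cayley" where
  "imag y = y - cd_coeff y 0 *\<^sub>R 1"

lemma bounded_linear_imag: "bounded_linear (imag :: 'r cayley \<Rightarrow> 'r cayley)"
  unfolding imag_def[abs_def]
  by (intro bounded_linear_sub bounded_linear_ident bounded_linear_scaleR_const bounded_linear_cd_coeff)

text \<open>With a unit imaginary v these are exp (- x v) = cos x - sin x v. In the Cartesian case x
  is the norm of the imaginary part, and both coefficients are expressed through x^2 to be smooth at
  0.\<close>

primrec exp_symbol :: "kernel \<Rightarrow> 'r cayley \<Rightarrow> 'r cayley" where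
  "exp_symbol Spherical y =
    cos (cd_coeff y 1) *\<^sub>R 1 - sin (cd_coeff y 1) *\<^sub>R sphere_direction (cd_coeff y)"
| "exp_symbol Cartesian y =
    cos_sqrt_deriv 0 ((norm (imag y))\<^sup>2) *\<^sub>R 1 + (2 * cos_sqrt_deriv 1 ((norm (imag y))\<^sup>2)) *\<^sub>R imag y"

lemma tempered_exp_symbol: "tempered m (exp_symbol u :: 'r cayley \<Rightarrow> 'r cayley)"
proof (cases u)
  case Spherical
  have trig: "tempered m (\<lambda>y :: 'r cayley. cos (cd_coeff y j))" "tempered m (\<lambda>y :: 'r cayley. sin (cd_coeff y j))" for j
    by (intro tempered_cos_sin tempered_cd_coeff)+
  have "tempered m (\<lambda>y :: 'r cayley. if j < K then cos (cd_coeff y (j + 1)) else 1)" for j K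
    by (cases "j < K") (simp_all add: trig tempered_const)
  then show ?thesis
    unfolding Spherical exp_symbol.simps[abs_def] sphere_direction_def Let_def
    by (intro tempered_diff tempered_scaleR tempered_sum tempered_mult tempered_prod trig tempered_const)
next
  case Cartesian
  have imag: "tempered m (imag :: 'r cayley \<Rightarrow> 'r cayley)" for m
    by (rule tempered_linear[OF bounded_linear_imag])
  have "tempered m (\<lambda>y :: 'r cayley. (norm (imag y))\<^sup>2)" for m
    unfolding power2_norm_eq_inner by (intro tempered_bilinear[OF bounded_bilinear_inner] imag)
  then have "tempered m (\<lambda>y :: 'r cayley. cos_sqrt_deriv j ((norm (imag y))\<^sup>2))" for j m
    by (rule tempered_cos_sqrt_deriv) simp
  then show ?thesis
    unfolding Cartesian exp_symbol.simps[abs_def]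
    by (intro tempered_add tempered_scaleR tempered_mult tempered_const imag)
qed

lemma cayley_exp_spherical:
  assumes "CARD('r) > 0"
  shows "cayley_exp (- (a *\<^sub>R 1 + cd_coeff y 1 *\<^sub>R sphere_direction (cd_coeff y))) =
    exp (- a) *\<^sub>R (exp_symbol Spherical y :: 'r cayley)"
proof -
  have sq: "sphere_direction (cd_coeff y) * sphere_direction (cd_coeff y) = (- 1 :: 'r cayley)"
    using assms by (intro cayley_imaginary_square norm_sphere_direction) (simp add: cd_coeff_sphere_direction)
  show ?thesis
    using cayley_exp_complex[OF sq, of "- a" "- cd_coeff y 1"] by simp
qed

lemma cayley_exp_cartesian:
  fixes y :: "'r cayley"
  assumes "CARD('r) > 0"
  shows "cayley_exp (- (a *\<^sub>R 1 + imag y)) = exp (- a) *\<^sub>R exp_symbol Cartesian y"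
proof (cases "imag y = 0")
  case True
  \<comment> \<open>No direction is distinguished here, so any imaginary unit serves, with angle 0;
    \<open>cbasis 1\<close> exists because the level is positive.\<close>
  have "(2::nat) ^ 1 \<le> 2 ^ CARD('r)" using assms by (intro power_increasing) auto
  then have "cbasis 1 * cbasis 1 = (- 1 :: 'r cayley)"
    by (intro cbasis_relations) auto
  from cayley_exp_complex[OF this, of "- a" 0] show ?thesis
    using True by (simp add: cos_sqrt_deriv_0)
next
  case False
  let ?x = "imag y" and ?N = "norm (imag y)"
  have "(?x /\<^sub>R ?N) * (?x /\<^sub>R ?N) = - 1"
    using False by (intro cayley_imaginary_square) (auto simp: imag_def)
  from cayley_exp_complex[OF this, of "- a" "- ?N"]
  have "cayley_exp (- (a *\<^sub>R 1 + ?x)) = exp (- a) *\<^sub>R (cos ?N *\<^sub>R 1 - (sin ?N / ?N) *\<^sub>R ?x)"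
    using False by (simp add: divide_inverse)
  moreover have "2 * cos_sqrt_deriv 1 (?N\<^sup>2) = - (sin ?N / ?N)"
    using cos_sqrt_deriv_1[of "?N\<^sup>2"] False by (simp add: field_simps)
  moreover have "cos_sqrt_deriv 0 (?N\<^sup>2) = cos ?N"
    by (simp add: cos_sqrt_deriv_0)
  ultimately show ?thesis by simp
qed


section \<open>The kernels as functions of a linear argument\<close>

definition index_axis :: "nat \<Rightarrow> real ^ 'n::{finite,linorder}" where
  "index_axis k = axis (sorted_list_of_set UNIV ! (k - 1)) 1"

lemma bij_betw_index_axis: "bij_betw index_axis {1..CARD('n)} (Basis :: (real ^ 'n::{finite,linorder}) set)"
proof -
  have "bij_betw (\<lambda>k. k - 1) {1..CARD('n)} {..<CARD('n)}"
    by (rule bij_betw_byWitness[of _ Suc]) auto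
  moreover have "bij_betw (\<lambda>i. sorted_list_of_set UNIV ! i) {..<CARD('n)} (UNIV :: 'n set)"
    by (rule bij_betw_nth) auto
  moreover have "bij_betw (\<lambda>i :: 'n. axis i (1 :: real)) UNIV Basis"
    by (auto simp: bij_betw_def inj_def axis_eq_axis Basis_vec_def)
  ultimately have "bij_betw ((\<lambda>i :: 'n. axis i (1 :: real)) \<circ> ((\<lambda>i. sorted_list_of_set UNIV ! i) \<circ> (\<lambda>k. k - 1)))
      {1..CARD('n)} Basis"
    by (intro bij_betw_trans)
  then show ?thesis by (simp add: index_axis_def[abs_def] o_def)
qed

lemma index_axis_Basis:
  "k \<in> {1..CARD('n)} \<Longrightarrow> (index_axis k :: real ^ 'n::{finite,linorder}) \<in> Basis"
  using bij_betwE[OF bij_betw_index_axis] by blast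

lemma tcoord_eq:
  fixes t :: "real ^ 'n::{finite,linorder}"
  shows "tcoord t j = (if j \<in> {1..CARD('n)} then t \<bullet> index_axis j else 0)"
  by (simp add: tcoord_def index_axis_def inner_axis)

lemma tcoord_index_axis:
  assumes "k \<in> {1..CARD('n)}"
  shows "tcoord (index_axis k :: real ^ 'n::{finite,linorder}) j = (if j = k then 1 else 0)"
proof (cases "j \<in> {1..CARD('n)}")
  case True
  then have "index_axis j = (index_axis k :: real ^ 'n::{finite,linorder}) \<longleftrightarrow> j = k"
    using assms bij_betw_imp_inj_on[OF bij_betw_index_axis] by (auto dest: inj_onD)
  then show ?thesis
    using True assms index_axis_Basis[of j, where 'n = 'n] index_axis_Basis[of k, where 'n = 'n]
    by (auto simp: tcoord_eq inner_Basis)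
qed (use assms in \<open>auto simp: tcoord_eq\<close>)

lemma bounded_linear_tcoord: "bounded_linear (\<lambda>t :: real ^ 'n::{finite,linorder}. tcoord t j)"
  unfolding tcoord_eq
  by (cases "j \<in> {1..CARD('n)}") (simp_all add: bounded_linear_inner_left del: atLeastAtMost_iff)

lemma bounded_linear_tail_sum: "bounded_linear (\<lambda>t. tail_sum t j)"
  unfolding tail_sum_def by (intro bounded_linear_sum bounded_linear_tcoord)

lemma sum_tcoord: "(\<Sum>j=1..CARD('n). tcoord t j) = coord_sum (t :: real ^ 'n::{finite,linorder})"
proof -
  have "(\<Sum>j=1..CARD('n). tcoord t j) = (\<Sum>j=1..CARD('n). t \<bullet> index_axis j)"
    by (intro sum.cong) (auto simp: tcoord_eq)
  also have "\<dots> = coord_sum t"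
    unfolding coord_sum_def by (rule sum.reindex_bij_betw[OF bij_betw_index_axis])
  finally show ?thesis .
qed

primrec argument_coeff :: "kernel \<Rightarrow> real ^ 'n::{finite,linorder} \<Rightarrow> nat \<Rightarrow> real" where
  "argument_coeff Spherical t = tail_sum t"
| "argument_coeff Cartesian t = tcoord t"

text \<open>After adding \<zeta>, the coordinates of positive index are the phases of the spherical
  kernel or the imaginary coordinates of the Cartesian one. The term with p_0 is absent, as it sits
  in the exponential factor of \<open>damped\<close>.\<close>

definition kernel_argument ::
  "kernel \<Rightarrow> 'r cayley \<Rightarrow> real ^ 'n::{finite,linorder} \<Rightarrow> 'r cayley" where
  "kernel_argument u p t = (\<Sum>j=1..CARD('n). (cd_coeff p j * argument_coeff u t j) *\<^sub>R cbasis j)"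

lemma bounded_linear_kernel_argument: "bounded_linear (kernel_argument u p)"
proof -
  have "bounded_linear (\<lambda>t. argument_coeff u t j)" for j
    by (cases u) (simp_all add: bounded_linear_tail_sum bounded_linear_tcoord)
  then show ?thesis
    unfolding kernel_argument_def[abs_def]
    by (intro bounded_linear_sum bounded_linear_scaleR_const bounded_linear_const_mult)
qed

text \<open>The coordinate t_k occurs in the tail sum s_j exactly for j \<le> k. This explains why
  the spherical R_k differentiates in the directions 1 to k, the Cartesian one only in direction
  k.\<close>

lemma kernel_argument_index_axis:
  assumes "k \<in> {1..CARD('n)}"
  shows "kernel_argument u p (index_axis k :: real ^ 'n::{finite,linorder}) =
    (\<Sum>j\<in>R_directions u k. cd_coeff p j *\<^sub>R cbasis j)"
proof -
  have "argument_coeff u (index_axis k :: real ^ 'n::{finite,linorder}) j = (if j \<in> R_directions u k then 1 else 0)"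
    if "j \<in> {1..CARD('n)}" for j
    using that assms by (cases u) (auto simp: tail_sum_def tcoord_index_axis)
  then have "kernel_argument u p (index_axis k :: real ^ 'n::{finite,linorder}) =
      (\<Sum>j=1..CARD('n). if j \<in> R_directions u k then cd_coeff p j *\<^sub>R cbasis j else 0)"
    unfolding kernel_argument_def by (intro sum.cong) auto
  also have "\<dots> = (\<Sum>j\<in>R_directions u k. cd_coeff p j *\<^sub>R cbasis j)"
  proof -
    have "R_directions u k \<subseteq> {1..CARD('n)}"
      using assms by (cases u) auto
    then show ?thesis
      by (simp add: sum.inter_restrict[symmetric] Int_absorb1 del: atLeastAtMost_iff)
  qed
  finally show ?thesis .
qed

lemma cd_coeff_kernel_argument:
  fixes p :: "'r cayley" and t :: "real ^ 'n::{finite,linorder}"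
  assumes "CARD('n) < 2 ^ CARD('r)"
  shows "cd_coeff (kernel_argument u p t) j =
    (if j \<in> {1..CARD('n)} then cd_coeff p j * argument_coeff u t j else 0)"
proof -
  have "cd_coeff (kernel_argument u p t) j =
      (\<Sum>i=1..CARD('n). if i = j then cd_coeff p i * argument_coeff u t i else 0)"
    unfolding kernel_argument_def cd_coeff_sum using assms
    by (intro sum.cong) (auto simp: cd_coeff_cbasis)
  then show ?thesis by simp
qed

lemma cayley_exp_kernel:
  fixes p \<zeta> :: "'r cayley" and t :: "real ^ 'n::{finite,linorder}"
  assumes n: "CARD('n) < 2 ^ CARD('r)" and r: "CARD('r) > 0"
  shows "cayley_exp (- kernel_fun u p t \<zeta>) =
    exp (- cd_coeff \<zeta> 0) *\<^sub>R damped (cd_coeff p 0) (kernel_argument u p) (exp_symbol u) \<zeta> t"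
proof -
  let ?a = "cd_coeff p 0 * coord_sum t + cd_coeff \<zeta> 0" and ?y = "kernel_argument u p t + \<zeta>"
  have "cayley_exp (- kernel_fun u p t \<zeta>) = exp (- ?a) *\<^sub>R exp_symbol u ?y"
  proof (cases u)
    case Spherical
    have phase: "phase p t \<zeta> j = cd_coeff ?y j" if "j \<ge> 1" for j
      using n that by (auto simp: Spherical phase_def cd_coeff_kernel_argument tail_sum_def)
    have "sphere_direction (phase p t \<zeta>) = (sphere_direction (cd_coeff ?y) :: 'r cayley)"
      unfolding sphere_direction_def Let_def
      by (intro sum.cong arg_cong2[where f = scaleR] arg_cong2[where f = times] prod.cong)
        (auto simp: phase)
    then have "spherical_kernel p t \<zeta> = ?a *\<^sub>R 1 + cd_coeff ?y 1 *\<^sub>R sphere_direction (cd_coeff ?y)"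
      using sum_tcoord[of t] phase[of 1]
      by (simp add: spherical_kernel_def Let_def sphere_direction_def tail_sum_def scaleR_left_distrib)
    then show ?thesis
      using cayley_exp_spherical[OF r, of ?a ?y] Spherical by simp
  next
    case Cartesian
    have "cartesian_kernel p t \<zeta> = (cd_coeff p 0 * coord_sum t) *\<^sub>R 1 + ?y"
      using sum_tcoord[of t] by (simp add: cartesian_kernel_def kernel_argument_def Cartesian)
    \<comment> \<open>The real coordinate of \<open>?y\<close> is \<zeta>_0, which moves into
      \<open>?a\<close>.\<close>
    also have "\<dots> = ?a *\<^sub>R 1 + imag ?y"
      using n by (simp add: imag_def cd_coeff_kernel_argument scaleR_left_distrib)
    finally show ?thesis
      using cayley_exp_cartesian[OF r, of ?a ?y] Cartesian by simp
  qed
  also have "exp (- ?a) = exp (- cd_coeff \<zeta> 0) * exp (- (cd_coeff p 0 * coord_sum t))"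
    unfolding exp_add[symmetric] by simp
  finally show ?thesis by (simp add: damped_def)
qed

section \<open>The operators acting on the transforms\<close>

context damped_transform
begin

abbreviation weighted_integral :: "('r cayley \<Rightarrow> 'r cayley) \<Rightarrow> 'r cayley \<Rightarrow> 'r cayley" where
  "weighted_integral \<psi> \<zeta> \<equiv> exp (- cd_coeff \<zeta> 0) *\<^sub>R damped_integral g a Y \<psi> \<zeta>"

lemma weighted_integral_derivative:
  assumes "tempered (Suc m) \<psi>" "j > 0"
  shows "((\<lambda>h. weighted_integral \<psi> (\<zeta> + h *\<^sub>R cbasis j)) has_vector_derivative
    weighted_integral (\<lambda>y. frechet_derivative \<psi> (at y) (cbasis j)) \<zeta>) (at 0)"
proof -
  \<comment> \<open>A step in a direction of positive index leaves the factor exp (- \<zeta>_0)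
    constant.\<close>
  have "cd_coeff (\<zeta> + h *\<^sub>R cbasis j) 0 = cd_coeff \<zeta> 0" for h
    using assms(2) by (simp add: cd_coeff_cbasis)
  then show ?thesis
    using bounded_linear.has_vector_derivative[OF bounded_linear_scaleR_right damped_integral_derivative[OF
        tempered_0I[OF assms(1)] tempered_frechet_derivative(1)[OF assms(1)]
        tempered_0I[OF tempered_frechet_derivative(2)[OF assms(1)]]], of "exp (- cd_coeff \<zeta> 0)" \<zeta> "cbasis j"]
    by (simp only:)
qed

text \<open>The operator passes under the integral and acts on \<psi> through its symbol; the minus
  sign of the symbol is that of S_j.\<close>

lemma R_op_weighted_integral:
  assumes \<psi>: "tempered (Suc m) \<psi>" and k: "k > 0"
    and a: "a = cd_coeff p 0"
  shows "R_op u p k (weighted_integral \<psi>) =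
    weighted_integral (symbol a (\<Sum>j\<in>R_directions u k. cd_coeff p j *\<^sub>R cbasis j) \<psi>)"
proof
  fix \<zeta> :: "'r cayley"
  have R: "R_op u p k F = (\<lambda>\<zeta>. cd_coeff p 0 *\<^sub>R F \<zeta> + (\<Sum>j\<in>R_directions u k. cd_coeff p j *\<^sub>R S_op j F \<zeta>))"
    for F :: "'r cayley \<Rightarrow> 'r cayley"
    by (cases u) simp_all
  have pos: "j > 0" if "j \<in> R_directions u k" for j
    using that k by (cases u) auto
  have fin: "finite (R_directions u k)" by (cases u) auto
  have S: "S_op j (weighted_integral \<psi>) \<zeta> = - weighted_integral (\<lambda>y. frechet_derivative \<psi> (at y) (cbasis j)) \<zeta>"
    if "j \<in> R_directions u k" for j
    unfolding S_op_def
    using vector_derivative_at[OF weighted_integral_derivative[OF \<psi> pos[OF that], of \<zeta>]] by simp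
  have "damped_integral g a Y (symbol a (\<Sum>j\<in>R_directions u k. cd_coeff p j *\<^sub>R cbasis j) \<psi>) \<zeta> =
      a *\<^sub>R damped_integral g a Y \<psi> \<zeta> -
      (\<Sum>j\<in>R_directions u k. cd_coeff p j *\<^sub>R
        damped_integral g a Y (\<lambda>y. frechet_derivative \<psi> (at y) (cbasis j)) \<zeta>)"
    unfolding symbol_def
    by (rule damped_integral_symbol[OF tempered_0I[OF \<psi>] tempered_0I[OF tempered_frechet_derivative(2)[OF \<psi>]]
        has_derivative_linear[OF tempered_frechet_derivative(1)[OF \<psi>]] fin])
  moreover have "(\<Sum>j\<in>R_directions u k. cd_coeff p j *\<^sub>R S_op j (weighted_integral \<psi>) \<zeta>) =
      (\<Sum>j\<in>R_directions u k. cd_coeff p j *\<^sub>R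
        - weighted_integral (\<lambda>y. frechet_derivative \<psi> (at y) (cbasis j)) \<zeta>)"
    by (intro sum.cong refl) (simp only: S)
  ultimately show "R_op u p k (weighted_integral \<psi>) \<zeta> =
      weighted_integral (symbol a (\<Sum>j\<in>R_directions u k. cd_coeff p j *\<^sub>R cbasis j) \<psi>) \<zeta>"
    by (simp add: R a[symmetric] sum_negf scaleR_right_diff_distrib scaleR_sum_right mult.commute)
qed

lemma R_comp_weighted_integral:
  assumes \<psi>: "tempered n \<psi>" and a: "a = cd_coeff p 0"
    and k: "1 \<le> k" "k \<le> Suc n"
  shows "R_comp u p k n (weighted_integral \<psi>) = weighted_integral
    (iterated_symbol a (\<lambda>k. \<Sum>j\<in>R_directions u k. cd_coeff p j *\<^sub>R cbasis j) n \<psi> k)"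
  using k(2,1)
proof (induction k rule: inc_induct)
  case base
  then show ?case by (simp add: R_comp_def iterated_symbol_last)
next
  case (step k)
  let ?\<Psi> = "iterated_symbol a (\<lambda>k. \<Sum>j\<in>R_directions u k. cd_coeff p j *\<^sub>R cbasis j) n \<psi>"
  have "tempered (Suc (k - 1)) (?\<Psi> (Suc k))"
    using tempered_iterated_symbol[OF \<psi>, of "Suc k"] step by simp
  from R_op_weighted_integral[OF this _ a]
  have "R_op u p k (weighted_integral (?\<Psi> (Suc k))) = weighted_integral (?\<Psi> k)"
    using step by (simp add: iterated_symbol_step)
  moreover have "R_comp u p k n F = R_op u p k (R_comp u p (Suc k) n F)" for F
    using step by (simp add: R_comp_def upt_conv_Cons del: upt_Suc)
  ultimately show ?case using step by simp
qed

lemma R_applicable_weighted_integral: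
  assumes "tempered (Suc m) \<psi>" "k > 0"
  shows "R_applicable u n k (weighted_integral \<psi>)"
  unfolding R_applicable_def
proof (intro ballI allI impI)
  fix j \<zeta> assume "j \<in> R_directions u k"
  then have "j > 0" using assms(2) by (cases u) auto
  from weighted_integral_derivative[OF assms(1) this]
  show "(\<lambda>h. weighted_integral \<psi> (\<zeta> + h *\<^sub>R cbasis j)) differentiable (at 0)"
    unfolding has_vector_derivative_def by (rule differentiableI)
qed

end

section \<open>Originals and the transform\<close>

text \<open>The set of discontinuities is null, hence measurable, and f is continuous on its
  complement.\<close>

lemma lebesgue_measurable_AE_continuous:
  fixes f :: "'a::euclidean_space \<Rightarrow> 'b::euclidean_space"
  assumes "AE x in lebesgue. isCont f x"
  shows "f \<in> borel_measurable lebesgue"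
proof -
  let ?N = "{x. \<not> isCont f x}"
  have N: "?N \<in> null_sets lebesgue"
    using assms by (simp add: completion.AE_iff_null_sets)
  then have S: "- ?N \<in> sets lebesgue"
    by (auto simp: null_sets_def intro: Compl_in_sets_lebesgue[THEN iffD2])
  have "continuous_on (- ?N) f"
    by (intro continuous_at_imp_continuous_on) auto
  then have "f \<in> borel_measurable (lebesgue_on (- ?N))"
    using S by (rule continuous_imp_measurable_on_sets_lebesgue)
  then show ?thesis
    using lebesgue_measurable_diff_null[OF N] by blast
qed

lemma borel_representative:
  fixes f :: "'a::euclidean_space \<Rightarrow> 'b::euclidean_space"
  assumes "f \<in> borel_measurable lebesgue"
  obtains h where "h \<in> borel_measurable borel" "AE x in lborel. f x = h x"
proof -
  have "\<exists>g. g \<in> borel_measurable lborel \<and> (AE x in lborel. f x \<bullet> i = g x)" for i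
    using completion_ex_borel_measurable_real[of "\<lambda>x. f x \<bullet> i" lborel] assms by auto
  then obtain g where g: "\<And>i. g i \<in> borel_measurable lborel" "\<And>i. AE x in lborel. f x \<bullet> i = g i x"
    by metis
  show ?thesis
  proof (rule that)
    show "(\<lambda>x. \<Sum>i\<in>Basis. g i x *\<^sub>R i) \<in> borel_measurable borel"
      using g(1) by simp
    have "AE x in lborel. \<forall>i\<in>Basis. f x \<bullet> i = g i x"
      using g(2) by (intro AE_finite_allI) auto
    then show "AE x in lborel. f x = (\<Sum>i\<in>Basis. g i x *\<^sub>R i)"
    proof (rule AE_mp, intro AE_I2 impI)
      fix x assume "\<forall>i\<in>Basis. f x \<bullet> i = g i x"
      then have "(\<Sum>i\<in>Basis. g i x *\<^sub>R i) = (\<Sum>i\<in>Basis. (f x \<bullet> i) *\<^sub>R i)"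
        by simp
      then show "f x = (\<Sum>i\<in>Basis. g i x *\<^sub>R i)"
        by (simp add: euclidean_representation)
    qed
  qed
qed

lemma original_representative:
  fixes f :: "real ^ 'n::finite \<Rightarrow> 'r cayley"
  assumes "original a1 am1 (restrict_orthant f)" "a1 \<le> b"
  obtains \<phi> C where "\<phi> \<in> borel_measurable borel"
    "\<And>t. norm (\<phi> t) \<le> C * (indicator orthant t * exp (b * coord_sum t))"
    "AE t in lborel. restrict_orthant f t = \<phi> t" "restrict_orthant f \<in> borel_measurable lebesgue"
proof -
  let ?f = "restrict_orthant f"
  have meas: "?f \<in> borel_measurable lebesgue"
    using assms(1) by (intro lebesgue_measurable_AE_continuous) (simp add: original_def)
  \<comment> \<open>The sign vector that is constantly 1 singles out the orthant.\<close>
  have "\<exists>C>0. \<forall>t :: real ^ 'n. (\<forall>j. 1 * t $ j \<ge> 0) \<longrightarrow>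
      norm (?f t) < C * exp (\<Sum>j\<in>UNIV. (if (1 :: real) = 1 then a1 else am1) * t $ j)"
    using assms(1) unfolding original_def by (elim conjE allE[of _ "\<lambda>_. 1"]) auto
  then obtain C where C: "C > 0" "\<And>t. t \<in> orthant \<Longrightarrow> norm (?f t) \<le> C * exp (a1 * coord_sum t)"
    by (auto simp: orthant_def coord_sum_eq sum_distrib_left less_imp_le)
  let ?B = "\<lambda>t :: real ^ 'n. C * (indicator orthant t * exp (b * coord_sum t))"
  have f_bound: "norm (?f t) \<le> ?B t" for t
  proof (cases "t \<in> orthant")
    case True
    have "C * exp (a1 * coord_sum t) \<le> C * exp (b * coord_sum t)"
      using C(1) mult_right_mono[OF assms(2) coord_sum_nonneg[OF True]] by simp
    then show ?thesis using C(2)[OF True] True by simp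
  qed (simp add: restrict_orthant_def)
  obtain h where h [measurable]: "h \<in> borel_measurable borel" and ae: "AE t in lborel. ?f t = h t"
    using borel_representative[OF meas] by blast
  show ?thesis
  proof (rule that)
    \<comment> \<open>Setting h to 0 where the bound fails changes it only on a null set. The bound
      is 0 outside the orthant, so the new function vanishes there.\<close>
    let ?S = "{t. norm (h t) \<le> ?B t}"
    show "(\<lambda>t. indicator ?S t *\<^sub>R h t) \<in> borel_measurable borel"
      by measurable
    show "norm (indicator ?S t *\<^sub>R h t) \<le> ?B t" for t
      using C(1) by (auto simp: indicator_def)
    show "AE t in lborel. ?f t = indicator ?S t *\<^sub>R h t"
    proof (rule AE_mp[OF ae], intro AE_I2 impI)
      fix t assume "?f t = h t"
      with f_bound[of t] show "?f t = indicator ?S t *\<^sub>R h t" by simp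
    qed
  qed (rule meas)
qed

text \<open>Since \<phi> lives on the orthant, integrating it over all t below y is integrating over
  the box from 0 to y; for y outside the orthant no such t contributes, which reproduces the
  restriction.\<close>

lemma restrict_orthant_primitive:
  fixes f :: "real ^ 'n::finite \<Rightarrow> 'r cayley"
  assumes meas: "restrict_orthant f \<in> borel_measurable lebesgue"
    and \<phi> [measurable]: "\<phi> \<in> borel_measurable borel"
    and ae: "AE t in lborel. restrict_orthant f t = \<phi> t" and zero: "\<And>t. t \<notin> orthant \<Longrightarrow> \<phi> t = 0"
  shows "restrict_orthant (primitive f) = (\<lambda>y. LINT t|lborel. indicator orthant (y - t) *\<^sub>R \<phi> t)"
proof
  fix y :: "real ^ 'n"
  show "restrict_orthant (primitive f) y = (LINT t|lborel. indicator orthant (y - t) *\<^sub>R \<phi> t)"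
  proof (cases "y \<in> orthant")
    case True
    have "indicator (cbox 0 y) t *\<^sub>R f t = indicator orthant (y - t) *\<^sub>R restrict_orthant f t" for t
      by (auto simp: restrict_orthant_def indicator_def mem_box_cart orthant_def)
    then have "primitive f y = (LINT t|lebesgue. indicator orthant (y - t) *\<^sub>R restrict_orthant f t)"
      by (simp add: primitive_def set_lebesgue_integral_def)
    also have "\<dots> = (LINT t|lebesgue. indicator orthant (y - t) *\<^sub>R \<phi> t)"
    proof (rule integral_cong_AE)
      have [measurable]: "restrict_orthant f \<in> borel_measurable lebesgue" by fact
      have [measurable]: "(\<lambda>t. indicator orthant (y - t) :: real) \<in> borel_measurable lebesgue"
        by (rule measurable_completion) measurable
      show "(\<lambda>t. indicator orthant (y - t) *\<^sub>R restrict_orthant f t) \<in> borel_measurable lebesgue"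
        by measurable
      show "(\<lambda>t. indicator orthant (y - t) *\<^sub>R \<phi> t) \<in> borel_measurable lebesgue"
        by (rule measurable_completion) measurable
      show "AE t in lebesgue. indicator orthant (y - t) *\<^sub>R restrict_orthant f t = indicator orthant (y - t) *\<^sub>R \<phi> t"
        using AE_completion[OF ae] by (rule AE_mp) auto
    qed
    also have "\<dots> = (LINT t|lborel. indicator orthant (y - t) *\<^sub>R \<phi> t)"
      by (rule integral_completion) measurable
    finally show ?thesis using True by (simp add: restrict_orthant_def)
  next
    case False
    have "indicator orthant (y - t) *\<^sub>R \<phi> t = 0" for t
      using zero[of t] orthant_add[of t "y - t"] False by (cases "t \<in> orthant") (auto simp: indicator_def)
    then have "(LINT t|lborel. indicator orthant (y - t) *\<^sub>R \<phi> t) = 0"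
      by (simp only: Bochner_Integration.integral_zero)
    then show ?thesis using False by (simp add: restrict_orthant_def)
  qed
qed

text \<open>The passage from Lebesgue integrals of f to Borel integrals of its representative
  g.\<close>

lemma (in damped_transform) transform_eq:
  fixes f :: "real ^ 'n::finite \<Rightarrow> 'r cayley"
  assumes meas: "f \<in> borel_measurable lebesgue" and ae: "AE t in lborel. f t = g t"
    and \<psi>: "tempered m \<psi>"
    and E: "\<And>t. E t = c *\<^sub>R damped a Y \<psi> \<zeta> t"
  shows "integrable lebesgue (\<lambda>t. f t * E t)"
    "(LINT t|lebesgue. f t * E t) = c *\<^sub>R damped_integral g a Y \<psi> \<zeta>"
proof -
  have gE: "(\<lambda>t. g t * E t) = (\<lambda>t. c *\<^sub>R (g t * damped a Y \<psi> \<zeta> t))"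
    by (simp add: E cayley_distrib)
  have int: "integrable lborel (\<lambda>t. g t * E t)"
    unfolding gE using damped_integrable[OF \<psi>] by simp
  then have "integrable lebesgue (\<lambda>t. g t * E t)"
    by (subst integrable_completion) auto
  moreover have "E \<in> borel_measurable lborel"
    unfolding E[abs_def] measurable_lborel2
    by (intro borel_measurable_scaleR borel_measurable_const borel_measurable_continuous_onI
      damped_continuous Y tempered_continuous[OF \<psi>])
  then have fE: "(\<lambda>t. f t * E t) \<in> borel_measurable lebesgue"
    by (intro cayley_mult_measurable meas measurable_completion)
  moreover have "AE t in lebesgue. f t * E t = g t * E t"
    using AE_completion[OF ae] by (rule AE_mp) auto
  ultimately show "integrable lebesgue (\<lambda>t. f t * E t)"
    using integrable_cong_AE[of "\<lambda>t. f t * E t" lebesgue "\<lambda>t. g t * E t"] by auto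
  have "(LINT t|lebesgue. f t * E t) = (LINT t|lebesgue. g t * E t)"
    using \<open>integrable lebesgue (\<lambda>t. g t * E t)\<close> \<open>AE t in lebesgue. f t * E t = g t * E t\<close>
    by (intro integral_cong_AE fE) auto
  also have "\<dots> = (LINT t|lborel. g t * E t)"
    using int by (intro integral_completion) auto
  also have "\<dots> = c *\<^sub>R damped_integral g a Y \<psi> \<zeta>"
    unfolding gE damped_integral_def by simp
  finally show "(LINT t|lebesgue. f t * E t) = c *\<^sub>R damped_integral g a Y \<psi> \<zeta>" .
qed

text \<open>The primitive may exceed the rate b by any \<delta> > 0. A rate b \<ge> 0 enters here,
  since integration does not preserve decay; this is the 0 in the maximum that bounds the
  domain.\<close>

lemma primitive_bound:
  fixes \<phi> :: "real ^ 'n::finite \<Rightarrow> 'c::euclidean_space"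
  assumes \<phi> [measurable]: "\<phi> \<in> borel_measurable borel"
    and bound: "\<And>t. norm (\<phi> t) \<le> C * (indicator orthant t * exp (b * coord_sum t))"
    and b: "0 \<le> b" and \<delta>: "0 < \<delta>"
  shows "norm (LINT t|lborel. indicator orthant (y - t) *\<^sub>R \<phi> t) \<le>
    C * (LINT t|lborel. indicator orthant t * exp (- (\<delta> * coord_sum (t :: real ^ 'n)))) *
      (indicator orthant y * exp ((b + \<delta>) * coord_sum y))"
proof (cases "y \<in> orthant")
  case True
  let ?w = "\<lambda>t :: real ^ 'n. indicator orthant t * exp (- (\<delta> * coord_sum t)) :: real"
  have w: "integrable lborel ?w" by (rule integrable_exp_orthant[OF \<delta>])
  have "norm (LINT t|lborel. indicator orthant (y - t) *\<^sub>R \<phi> t) \<le>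
      (LINT t|lborel. norm (indicator orthant (y - t) *\<^sub>R \<phi> t))"
    by (rule integral_norm_bound)
  also have "\<dots> \<le> (LINT t|lborel. (C * exp ((b + \<delta>) * coord_sum y)) * ?w t)"
  proof (rule integral_mono')
    show "integrable lborel (\<lambda>t. (C * exp ((b + \<delta>) * coord_sum y)) * ?w t)"
      by (intro integrable_mult_right w)
    show "norm (indicator orthant (y - t) *\<^sub>R \<phi> t) \<le> (C * exp ((b + \<delta>) * coord_sum y)) * ?w t" for t
      by (rule order_translate_bound[OF bound b less_imp_le[OF \<delta>]])
    then show "0 \<le> (C * exp ((b + \<delta>) * coord_sum y)) * ?w t" for t
      using norm_ge_zero order_trans by blast
  qed
  also have "\<dots> = C * (LINT t|lborel. ?w t) * exp ((b + \<delta>) * coord_sum y)"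
    by simp
  finally show ?thesis using True by simp
next
  case False
  have "indicator orthant (y - t) *\<^sub>R \<phi> t = 0" for t
    using bound[of t] orthant_add[of t "y - t"] False by (cases "t \<in> orthant") (auto simp: indicator_def)
  then have "(LINT t|lborel. indicator orthant (y - t) *\<^sub>R \<phi> t) = 0"
    by (simp only: Bochner_Integration.integral_zero)
  then show ?thesis using False by simp
qed

theorem theorem26:
  fixes f :: "real ^ 'n::{finite,linorder} \<Rightarrow> 'r cayley"
    and p \<zeta> :: "'r cayley"
    and a1 am1 :: real
    and u :: kernel
  assumes "2 \<le> CARD('r)"
    and "2 ^ (CARD('r) - 1) \<le> CARD('n)"
    and "CARD('n) \<le> 2 ^ CARD('r) - 1"
    and "original a1 am1 (restrict_orthant f)"
    and "vanishes_above CARD('n) p"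
    and "vanishes_above CARD('n) \<zeta>"
    and "cayley_Re p > max a1 0"
  shows "integrable lebesgue (transform_integrand (restrict_orthant f) u p \<zeta>)
    \<and> integrable lebesgue (transform_integrand (restrict_orthant (primitive f)) u p \<zeta>)
    \<and> (\<forall>k\<in>{1..CARD('n)}. R_applicable u CARD('n) k
        (R_comp u p (Suc k) CARD('n) (transform (restrict_orthant (primitive f)) u p)))
    \<and> transform (restrict_orthant f) u p \<zeta> =
        R_comp u p 1 CARD('n) (transform (restrict_orthant (primitive f)) u p) \<zeta>"
proof -
  let ?n = "CARD('n)" and ?Y = "kernel_argument u p :: real ^ 'n::{finite,linorder} \<Rightarrow> 'r cayley" and ?\<psi> = "exp_symbol u :: 'r cayley \<Rightarrow> 'r cayley"
  let ?w = "\<lambda>k. \<Sum>j\<in>R_directions u k. cd_coeff p j *\<^sub>R cbasis j :: 'r cayley"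
  define a where "a = cd_coeff p 0"
  define b where "b = max a1 0"
  \<comment> \<open>The rate b + \<delta> of the primitive stays below a, so both transforms
    converge in the same domain.\<close>
  define \<delta> where "\<delta> = (a - b) / 2"
  have ab: "0 \<le> b" "b < a" "a1 \<le> b"
    using assms(7) by (auto simp: a_def b_def cayley_Re_def cd_coeff_cnj)
  then have \<delta>: "\<delta> > 0" "b + \<delta> < a" by (auto simp: \<delta>_def field_simps)
  have "0 < (2 :: nat) ^ CARD('r)" by simp
  then have dim: "?n < 2 ^ CARD('r)" "CARD('r) > 0" using assms(1,3) by linarith+
  obtain \<phi> C where \<phi>: "\<phi> \<in> borel_measurable borel"
    "\<And>t. norm (\<phi> t) \<le> C * (indicator orthant t * exp (b * coord_sum t))"
    "AE t in lborel. restrict_orthant f t = \<phi> t" "restrict_orthant f \<in> borel_measurable lebesgue"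
    using original_representative[OF assms(4) ab(3)] by metis
  define G where "G = (\<lambda>y. LINT t|lborel. indicator orthant (y - t) *\<^sub>R \<phi> t)"
  have \<phi>_zero: "\<phi> t = 0" if "t \<notin> orthant" for t using \<phi>(2)[of t] that by simp
  have primitive: "restrict_orthant (primitive f) = G"
    unfolding G_def using \<phi>(4,1,3) \<phi>_zero by (rule restrict_orthant_primitive)
  have G [measurable]: "G \<in> borel_measurable borel"
    unfolding G_def using \<phi>(1) by measurable
  interpret f: damped_transform \<phi> C a b ?Y
    by (intro damped_transform.intro \<phi>(1,2) ab(2) bounded_linear_kernel_argument)
  interpret g: damped_transform G "C * (LINT t|lborel. indicator orthant t * exp (- (\<delta> * coord_sum (t :: real ^ 'n::{finite,linorder}))))"
      a "b + \<delta>" ?Y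
    by (intro damped_transform.intro G \<delta>(2) bounded_linear_kernel_argument)
      (unfold G_def, rule primitive_bound[OF \<phi>(1,2) ab(1) \<delta>(1)])
  have E: "cayley_exp (- kernel_fun u p t \<zeta>) = exp (- cd_coeff \<zeta> 0) *\<^sub>R damped a ?Y ?\<psi> \<zeta> t" for t \<zeta>
    unfolding a_def by (rule cayley_exp_kernel[OF dim])
  have G_meas: "G \<in> borel_measurable lebesgue"
    by (rule measurable_completion) simp
  note F1 = f.transform_eq[OF \<phi>(4,3) tempered_exp_symbol E]
  note F2 = g.transform_eq[OF G_meas AE_I2[OF refl] tempered_exp_symbol E]
  have T: "transform (restrict_orthant (primitive f)) u p = g.weighted_integral ?\<psi>"
    by (rule ext) (simp add: transform_def transform_integrand_def primitive F2(2))
  have R: "R_comp u p k ?n (transform (restrict_orthant (primitive f)) u p) =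
      g.weighted_integral (iterated_symbol a ?w ?n ?\<psi> k)" if "1 \<le> k" "k \<le> Suc ?n" for k
    unfolding T by (rule g.R_comp_weighted_integral[OF tempered_exp_symbol a_def that])
  have "R_applicable u ?n k (R_comp u p (Suc k) ?n (transform (restrict_orthant (primitive f)) u p))"
    if k: "k \<in> {1..?n}" for k
  proof -
    \<comment> \<open>Before R_k acts, the symbol still has k \<ge> 1 orders of
      differentiability.\<close>
    have "tempered (Suc (k - 1)) (iterated_symbol a ?w ?n ?\<psi> (Suc k))"
      using tempered_iterated_symbol[OF tempered_exp_symbol, of "Suc k" ?n a ?w u] k by simp
    from g.R_applicable_weighted_integral[OF this, of k u ?n]
    show ?thesis using R[of "Suc k"] k by simp
  qed
  moreover have "transform (restrict_orthant f) u p \<zeta> =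
      exp (- cd_coeff \<zeta> 0) *\<^sub>R damped_integral \<phi> a ?Y ?\<psi> \<zeta>"
    by (simp add: transform_def transform_integrand_def F1(2))
  then have "transform (restrict_orthant f) u p \<zeta> = g.weighted_integral (iterated_symbol a ?w ?n ?\<psi> 1) \<zeta>"
    using damped_integral_by_parts[OF \<phi>(1,2) ab(1,2) bounded_linear_kernel_argument bij_betw_index_axis
      kernel_argument_index_axis tempered_exp_symbol] by (simp add: G_def)
  then have "transform (restrict_orthant f) u p \<zeta> =
      R_comp u p 1 ?n (transform (restrict_orthant (primitive f)) u p) \<zeta>"
    using R[of 1] by simp
  ultimately show ?thesis
    using F1(1) F2(1) by (simp add: transform_integrand_def[abs_def] primitive)
qed

end
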